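(* Let $(X,\|\cdot\|_X)$ be a Banach space and let $I\in C^1(X,\mathbb{R})$ satisfy: (A1) $I(0)=0$, $I(u)$ is even in $u$ and bounded from below; (A2'') $I(u)$ satisfies the $(PS)_c$ condition for all $c\le 0$; (A3) for any $k\in\mathbb{N}$ there exists $A\in\mathcal{E}$ such that $\gamma(A)\ge k$ and $\sup_{u\in A}I(u)<0$. Assume that there does not exist a sequence $(u_j)_{j=1}^\infty\subset X$ such that $I'(u_j)=0$ and $I(u_j)<0$ for all $j$ and $u_j\to 0$ as $j\to\infty$. Then $\widehat K_0\neq\{0\}$.
   Context: $X$ is a real Banach space with dual $X^*$; $\mathbb{N}=\{1,2,\dots\}$. $(PS)_c$: for $c\in\mathbb{R}$, $I$ satisfies $(PS)_c$ if any sequence $(u_j)_{j=1}^\infty\subset X$ with $I(u_j)\to c$ and $\|I'(u_j)\|_{X^*}\to 0$ has a (norm-)convergent subsequence. $\mathcal{E}$ is the family of sets $A\subset X\setminus\{0\}$ that are closed (in $X$) and symmetric with respect to $0$. For $A\in\mathcal{E}$, the (Krasnosel'skii) genus $\gamma(A)$ is the smallest integer $n$ such that there exists an odd continuous map $\zeta\in C(A,\mathbb{R}^n\setminus\{0\})$; if no such map exists for any $n$, $\gamma(A)=\infty$; $\gamma(\emptyset)=0$. $K_0=\{u\in X: I'(u)=0,\ I(u)=0\}$ (which contains $0$), and $\widehat K_0$ is the connected component of $K_0$ containing $0$. *)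

theory Defs
  imports "HOL-Analysis.Analysis" "HOL-Library.Extended_Nat" "HOL-Library.Extended_Real"
begin

text \<open>
  A \<open>C\<^sup>1\<close> functional comes with its Frechet derivative \<open>I'\<close>, which is determined by \<open>I\<close>.
  The type \<open>'a \<Rightarrow>\<^sub>L real\<close> is the dual space and its norm is the dual norm.
\<close>

definition C1_functional ::
  "('a::real_normed_vector \<Rightarrow> real) \<Rightarrow> ('a \<Rightarrow> 'a \<Rightarrow>\<^sub>L real) \<Rightarrow> bool" where
  "C1_functional I I' \<longleftrightarrow>
     (\<forall>u. (I has_derivative blinfun_apply (I' u)) (at u)) \<and> continuous_on UNIV I'"

definition PS_cond ::
  "('a::real_normed_vector \<Rightarrow> real) \<Rightarrow> ('a \<Rightarrow> 'a \<Rightarrow>\<^sub>L real) \<Rightarrow> real \<Rightarrow> bool" where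
  "PS_cond I I' c \<longleftrightarrow>
     (\<forall>u::nat \<Rightarrow> 'a.
        (\<lambda>j. I (u j)) \<longlonglongrightarrow> c \<and> (\<lambda>j. norm (I' (u j))) \<longlonglongrightarrow> 0 \<longrightarrow>
        (\<exists>r::nat \<Rightarrow> nat. strict_mono r \<and> convergent (u \<circ> r)))"

definition sym_closed_sets :: "'a::real_normed_vector set set" where
  "sym_closed_sets = {A. closed A \<and> 0 \<notin> A \<and> (\<forall>u\<in>A. - u \<in> A)}"

text \<open>
  \<open>Euclidean_space n\<close> represents \<open>\<real>\<^sup>n\<close> by the sequences vanishing from index \<open>n\<close> on, so its
  origin is \<open>\<lambda>i. 0\<close>.
\<close>

definition odd_map_to_punctured ::
  "'a::real_normed_vector set \<Rightarrow> nat \<Rightarrow> ('a \<Rightarrow> nat \<Rightarrow> real) \<Rightarrow> bool" where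
  "odd_map_to_punctured A n \<zeta> \<longleftrightarrow>
     continuous_map (top_of_set A) (subtopology (Euclidean_space n) (- {\<lambda>i. 0})) \<zeta> \<and>
     (\<forall>u\<in>A. \<forall>i. \<zeta> (- u) i = - \<zeta> u i)"

text \<open>
  The infimum of the empty set is \<open>\<infinity>\<close>. Only the empty set has a map into the empty set
  \<open>\<real>\<^sup>0 - {0}\<close>, so the value at \<open>{}\<close>, and only there, is \<open>0\<close>.
\<close>

definition genus :: "'a::real_normed_vector set \<Rightarrow> enat" where
  "genus A = Inf {enat n | n. \<exists>\<zeta>. odd_map_to_punctured A n \<zeta>}"

definition zero_critical_set ::
  "('a::real_normed_vector \<Rightarrow> real) \<Rightarrow> ('a \<Rightarrow> 'a \<Rightarrow>\<^sub>L real) \<Rightarrow> 'a set" where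
  "zero_critical_set I I' = {u. I' u = 0 \<and> I u = 0}"

text \<open>
  \<open>connected_component_set S x\<close> is empty when \<open>x \<notin> S\<close>; the next lemma excludes this degenerate
  case for the component of \<open>0\<close> below.
\<close>

lemma zero_in_zero_critical_set:
  assumes C1: "C1_functional I I'" and "I 0 = 0" and ev: "\<And>u. I (- u) = I u"
  shows "0 \<in> zero_critical_set I I'"
proof -
  have d: "(I has_derivative blinfun_apply (I' 0)) (at 0)"
    using C1 by (simp add: C1_functional_def)
  have m: "((\<lambda>u::'a. - u) has_derivative (\<lambda>h. - h)) (at 0)"
    by (intro derivative_intros)
  have "((\<lambda>u. I (- u)) has_derivative (\<lambda>h. blinfun_apply (I' 0) (- h))) (at 0)"
    using has_derivative_compose[OF m, of I "blinfun_apply (I' 0)"] d by simp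
  then have "(I has_derivative (\<lambda>h. blinfun_apply (I' 0) (- h))) (at 0)"
    by (simp add: ev)
  then have eq: "blinfun_apply (I' 0) = (\<lambda>h. blinfun_apply (I' 0) (- h))"
    using d has_derivative_unique by blast
  have "blinfun_apply (I' 0) h = 0" for h
    using fun_cong[OF eq, of h] by (simp add: blinfun.minus_right)
  then have "I' 0 = 0"
    by (intro blinfun_eqI) simp
  then show ?thesis
    using assms(2) by (simp add: zero_critical_set_def)
qed

definition zero_critical_component ::
  "('a::real_normed_vector \<Rightarrow> real) \<Rightarrow> ('a \<Rightarrow> 'a \<Rightarrow>\<^sub>L real) \<Rightarrow> 'a set" where
  "zero_critical_component I I' = connected_component_set (zero_critical_set I I') 0"

end

theory Submission
  imports Defs
begin

text \<open>
  The proof runs Clark's minimax argument up to and including the critical level \<open>0\<close>. Write \<open>Y a\<close> for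
  the sublevel set \<open>{u. I u \<le> a}\<close>, and let \<open>c\<close> be the supremum of the levels \<open>a < 0\<close> for which \<open>Y a\<close>
  has an odd map into some \<open>\<real>\<^sup>n - {0}\<close>, that is, finite genus. Such levels exist because \<open>Y a\<close> is empty
  below the infimum of \<open>I\<close>.

  The engine is \<open>odd_map_on_higher_sublevel\<close>. Suppose that \<open>Y a\<close> maps oddly into \<open>\<real>\<^sup>p - {0}\<close>, and that on
  the band \<open>a \<le> I \<le> b\<close> the derivative is bounded away from zero except near a compact set \<open>K\<close> that does
  not contain \<open>0\<close>. A neighbourhood of \<open>K\<close> maps oddly into some \<open>\<real>\<^sup>m - {0}\<close>
  (\<open>odd_cutoff_near_compact\<close>). If the band is thin compared with the gradient bound in an annulus
  around \<open>K\<close>, then a descent starting outside the neighbourhood cannot reach \<open>K\<close> before it falls below \<open>a\<close>,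
  so the rest of \<open>Y b\<close> is deformed into \<open>Y a\<close> by an odd map (\<open>odd_deformation\<close>), and \<open>Y b\<close> maps oddly into
  \<open>\<real>\<^bsup>p+m\<^esup> - {0}\<close>.

  If \<open>c < 0\<close>, apply this to the critical set \<open>K\<close> at level \<open>c\<close>, which is compact by the Palais-Smale
  condition: the genus is finite at some level above \<open>c\<close>, a contradiction. If \<open>c = 0\<close> and the
  component of \<open>0\<close> in the critical set at level \<open>0\<close> is trivial, this critical set splits into a
  symmetric compact part \<open>K1\<close> in a small ball around \<open>0\<close> and a compact part \<open>K2\<close> away from \<open>0\<close>
  (\<open>split_off_point_component\<close>). By hypothesis a small ball contains no critical points with negative
  values, so for a fixed \<open>a < 0\<close> close to \<open>0\<close> and every \<open>b\<close> between \<open>a\<close> and \<open>0\<close> the band has no critical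
  points off the neighbourhood of \<open>K2\<close>. The resulting gradient bound deteriorates near \<open>K1\<close> as \<open>b\<close> tends
  to \<open>0\<close>, but the one in the annulus around \<open>K2\<close> does not, and only the latter restricts the height of
  the band. Hence the genus of \<open>Y b\<close> is at most \<open>p + m\<close> for all \<open>b < 0\<close>, contrary to the existence of
  sets of arbitrarily large genus on which \<open>I\<close> has negative supremum.

  As \<open>I'\<close> is merely continuous, the deformation is an iteration of discrete steps along an odd
  continuous pseudo-gradient (\<open>odd_descent_step\<close>); completeness of the space prevents the orbits from
  stalling.
\<close>

section \<open>Continuous selections from half-spaces\<close>

text \<open>
  The half-space condition is convex and closed, so vectors that satisfy it locally may be averaged
  with countably many weights. The weights come from Stone's argument for the paracompactness of
  metric spaces: once the centres \<open>x\<close> are well-ordered, assign to \<open>y\<close> the first ball \<open>\<alpha> y\<close>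
  that contains it, and let \<open>E n\<close> consist of the points that lie deep in their ball, by the margin
  \<open>3 / 2^n\<close>. Two points of \<open>E n\<close> with different balls are at least \<open>3 / 2^n\<close> apart, so within
  \<open>1 / 2^n\<close> of \<open>E n\<close> the choice of the ball is locally constant and the cut-off vector field \<open>A n\<close>
  is continuous. The weighted sum of all \<open>A n\<close> converges uniformly, hence stays continuous, and every point
  of \<open>S\<close> lies in some \<open>E n\<close>, so that the total weight is positive.
\<close>

lemma continuous_selection_half_spaces:
  fixes S :: "'a::metric_space set" and g :: "'a \<Rightarrow> 'b::banach \<Rightarrow>\<^sub>L real" and f :: "'a \<Rightarrow> real"
  assumes loc: "\<And>x. x \<in> S \<Longrightarrow> \<exists>v r. norm v \<le> 1 \<and> r > 0 \<and> (\<forall>y\<in>S. dist x y < r \<longrightarrow> f y \<le> g y v)"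
  obtains V where "continuous_on S V"
    and "\<And>y. y \<in> S \<Longrightarrow> norm (V y) \<le> 1"
    and "\<And>y. y \<in> S \<Longrightarrow> f y \<le> g y (V y)"
proof -
  obtain v r where v: "\<And>x. x \<in> S \<Longrightarrow> norm (v x) \<le> 1" and r: "\<And>x. x \<in> S \<Longrightarrow> r x > 0"
    and good: "\<And>x y. x \<in> S \<Longrightarrow> y \<in> S \<Longrightarrow> dist x y < r x \<Longrightarrow> f y \<le> g y (v x)"
    using loc by metis
  obtain R :: "'a rel" where R: "well_order_on UNIV R"
    using well_order_on by blast
  then have wfR: "wf (R - Id)" and total: "total R"
    by (auto simp: well_order_on_def linear_order_on_def)
  define Q where "Q y = {x \<in> S. dist x y < r x}" for y
  have "\<exists>x\<in>Q y. \<forall>z\<in>Q y. z \<noteq> x \<longrightarrow> (z, x) \<notin> R" if "y \<in> S" for y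
  proof -
    have "y \<in> Q y" using that r by (simp add: Q_def)
    from wfE_min[OF wfR this] show ?thesis by (metis DiffI pair_in_Id_conv)
  qed
  then obtain \<alpha> where \<alpha>Q: "\<And>y. y \<in> S \<Longrightarrow> \<alpha> y \<in> Q y"
    and \<alpha>min: "\<And>y z. y \<in> S \<Longrightarrow> z \<in> Q y \<Longrightarrow> z \<noteq> \<alpha> y \<Longrightarrow> (z, \<alpha> y) \<notin> R"
    by metis
  define E where "E n = {y \<in> S. dist (\<alpha> y) y + 3 * (1/2)^n \<le> r (\<alpha> y)}" for n :: nat
  \<comment> \<open>The point whose ball comes later lies outside the earlier ball, by minimality of \<open>\<alpha>\<close>.\<close>
  have sep_aux: "3 * (1/2)^n \<le> dist y y'"
    if "y \<in> E n" "y' \<in> E n" "\<alpha> y \<noteq> \<alpha> y'" "(\<alpha> y, \<alpha> y') \<in> R" for y y' n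
  proof -
    have "y \<in> S" "y' \<in> S" using that by (auto simp: E_def)
    then have "\<alpha> y \<in> S" using \<alpha>Q by (auto simp: Q_def)
    have "\<alpha> y \<notin> Q y'" using \<alpha>min[OF \<open>y' \<in> S\<close>] that by blast
    then have "r (\<alpha> y) \<le> dist (\<alpha> y) y'" using \<open>\<alpha> y \<in> S\<close> by (simp add: Q_def)
    also have "\<dots> \<le> dist (\<alpha> y) y + dist y y'" by (rule dist_triangle)
    finally show ?thesis using that(1) by (simp add: E_def)
  qed
  have sep: "\<alpha> y = \<alpha> y'" if "y \<in> E n" "y' \<in> E n" "dist y y' < 3 * (1/2)^n" for y y' n
    using sep_aux[of y n y'] sep_aux[of y' n y] that total
    by (metis UNIV_I dist_commute not_less total_on_def)
  define w where "w n u = (if E n = {} then 0 else max 0 (1 - 2^n * infdist u (E n)))" for n u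
  have w0: "0 \<le> w n u" and w1: "w n u \<le> 1" for n u
    by (auto simp: w_def infdist_nonneg)
  have w_cont: "continuous_on UNIV (w n)" for n
    by (cases "E n = {}") (simp_all add: w_def continuous_intros)
  have near: "\<exists>y. y \<in> E n \<and> dist u y < (1/2)^n" if "w n u > 0" for n u
  proof -
    have ne: "E n \<noteq> {}" and "2^n * infdist u (E n) < 1"
      using that by (auto simp: w_def split: if_splits)
    then have "infdist u (E n) < (1/2)^n"
      by (simp add: power_one_over field_simps)
    then show ?thesis
      using ne by (auto simp: infdist_def cINF_less_iff)
  qed
  define c where "c n u = v (\<alpha> (SOME y. y \<in> E n \<and> dist u y < (1/2)^n))" for n u
  have c: "\<exists>y. y \<in> E n \<and> dist u y < (1/2)^n \<and> c n u = v (\<alpha> y)" if "w n u > 0" for n u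
    using someI_ex[OF near[OF that]] by (auto simp: c_def)
  define A where "A n u = w n u *\<^sub>R c n u" for n u
  have A_norm: "norm (A n u) \<le> w n u" for n u
  proof (cases "w n u > 0")
    case True
    then obtain y where "y \<in> E n" "c n u = v (\<alpha> y)" using c by blast
    then have "norm (c n u) \<le> 1" using v \<alpha>Q by (auto simp: E_def Q_def)
    then show ?thesis using True by (simp add: A_def mult_left_le)
  next
    case False
    then show ?thesis using w0[of n u] by (simp add: A_def)
  qed
  have A_good: "w n u * f u \<le> g u (A n u)" if "u \<in> S" for n u
  proof (cases "w n u > 0")
    case True
    then obtain y where y: "y \<in> E n" "dist u y < (1/2)^n" "c n u = v (\<alpha> y)" using c by blast
    have "\<alpha> y \<in> S" using y \<alpha>Q by (auto simp: E_def Q_def)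
    have "dist (\<alpha> y) u \<le> dist (\<alpha> y) y + dist u y" by (metis dist_commute dist_triangle)
    also have "\<dots> < r (\<alpha> y)"
    proof -
      have "(0::real) < (1/2)^n" by simp
      moreover have "dist (\<alpha> y) y + 3 * (1/2)^n \<le> r (\<alpha> y)" using y by (simp add: E_def)
      ultimately show ?thesis using y(2) by linarith
    qed
    finally have "f u \<le> g u (c n u)" using good[OF \<open>\<alpha> y \<in> S\<close> that] y by simp
    then show ?thesis using True by (simp add: A_def blinfun.scaleR_right)
  next
    case False
    then have "w n u = 0" using w0[of n u] by simp
    then show ?thesis by (simp add: A_def)
  qed
  have A_local: "\<exists>d. \<forall>u'. dist u' u < (1/2)^n / 2 \<longrightarrow> A n u' = w n u' *\<^sub>R d" for n u
  proof (cases "\<exists>u1. dist u1 u < (1/2)^n / 2 \<and> w n u1 > 0")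
    case True
    then obtain u1 where u1: "dist u1 u < (1/2)^n / 2" "w n u1 > 0" by blast
    then obtain y1 where y1: "y1 \<in> E n" "dist u1 y1 < (1/2)^n" using c by blast
    have "A n u' = w n u' *\<^sub>R v (\<alpha> y1)" if u': "dist u' u < (1/2)^n / 2" for u'
    proof (cases "w n u' > 0")
      case True
      then obtain y where y: "y \<in> E n" "dist u' y < (1/2)^n" "c n u' = v (\<alpha> y)" using c by blast
      have "dist y y1 \<le> dist u' y + dist u' u + dist u1 u + dist u1 y1"
        by (smt (verit) dist_commute dist_triangle)
      then have "dist y y1 < 3 * (1/2)^n" using y y1 u' u1 by linarith
      then have "\<alpha> y = \<alpha> y1" using sep y y1 by blast
      then show ?thesis using y by (simp add: A_def)
    next
      case False
      then have "w n u' = 0" using w0[of n u'] by simp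
      then show ?thesis by (simp add: A_def)
    qed
    then show ?thesis by blast
  next
    case False
    then have "\<forall>u'. dist u' u < (1/2)^n / 2 \<longrightarrow> w n u' = 0"
      using w0 by (meson order.antisym not_less)
    then show ?thesis by (auto simp: A_def)
  qed
  have A_cont: "continuous_on UNIV (A n)" for n
    unfolding continuous_on_eq_continuous_at[OF open_UNIV]
  proof
    fix u
    obtain d where d: "\<And>u'. dist u' u < (1/2)^n / 2 \<Longrightarrow> A n u' = w n u' *\<^sub>R d"
      using A_local by blast
    have "isCont (w n) u" using w_cont[of n] by (simp add: continuous_on_eq_continuous_at)
    then have "isCont (\<lambda>u'. w n u' *\<^sub>R d) u" by (intro continuous_intros)
    then show "isCont (A n) u"
      by (rule continuous_transform_within[where \<delta>="(1/2)^n / 2"]) (auto simp: d)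
  qed
  have half: "summable (\<lambda>n. (1/2::real)^n)" by simp
  define w' where "w' u = (\<Sum>n. (1/2)^n * w n u)" for u
  define A' where "A' u = (\<Sum>n. (1/2)^n *\<^sub>R A n u)" for u
  have w'_bd: "norm ((1/2)^n * w n u) \<le> (1/2)^n" for n u
    using w0 w1 by (simp add: mult_left_le)
  have A'_bd: "norm ((1/2)^n *\<^sub>R A n u) \<le> (1/2)^n * w n u" for n u
    using A_norm by simp
  have A'_bd': "norm ((1/2)^n *\<^sub>R A n u) \<le> (1/2)^n" for n u
    using A'_bd[of n u] w'_bd[of n u] by (smt (verit) real_norm_def)
  have w'_sum: "summable (\<lambda>n. (1/2)^n * w n u)" for u
    by (rule summable_comparison_test'[OF half]) (use w'_bd in blast)
  have A'_sumn: "summable (\<lambda>n. norm ((1/2)^n *\<^sub>R A n u))" for u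
    by (rule summable_comparison_test'[OF half]) (use A'_bd' in simp)
  have A'_sum: "summable (\<lambda>n. (1/2)^n *\<^sub>R A n u)" for u
    by (rule summable_norm_cancel[OF A'_sumn])
  have w'_cont: "continuous_on UNIV w'"
  proof -
    have "uniform_limit UNIV (\<lambda>k u. \<Sum>n<k. (1/2)^n * w n u) w' sequentially"
      unfolding w'_def by (rule Weierstrass_m_test[OF w'_bd half])
    moreover have "continuous_on UNIV (\<lambda>u. \<Sum>n<k. (1/2)^n * w n u)" for k
      by (intro continuous_intros w_cont)
    ultimately show ?thesis
      by (intro uniform_limit_theorem[OF always_eventually]) auto
  qed
  have A'_cont: "continuous_on UNIV A'"
  proof -
    have "uniform_limit UNIV (\<lambda>k u. \<Sum>n<k. (1/2)^n *\<^sub>R A n u) A' sequentially"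
      unfolding A'_def by (rule Weierstrass_m_test[OF A'_bd' half])
    moreover have "continuous_on UNIV (\<lambda>u. \<Sum>n<k. (1/2)^n *\<^sub>R A n u)" for k
      by (intro continuous_intros A_cont)
    ultimately show ?thesis
      by (intro uniform_limit_theorem[OF always_eventually]) auto
  qed
  have w'_pos: "w' u > 0" if u: "u \<in> S" for u
  proof -
    have "\<alpha> u \<in> Q u" using \<alpha>Q u by blast
    then have "(r (\<alpha> u) - dist (\<alpha> u) u) / 3 > 0" by (simp add: Q_def)
    from real_arch_pow_inv[OF this, of "1/2"]
    obtain n where "(1/2)^n < (r (\<alpha> u) - dist (\<alpha> u) u) / 3" by auto
    then have "u \<in> E n" using u by (simp add: E_def)
    then have "w n u = 1" by (auto simp: w_def)
    then show ?thesis unfolding w'_def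
      by (intro suminf_pos2[OF w'_sum, where i = n]) (auto simp: w0)
  qed
  have A'_norm: "norm (A' u) \<le> w' u" for u
  proof -
    have "norm (A' u) \<le> (\<Sum>n. norm ((1/2)^n *\<^sub>R A n u))"
      unfolding A'_def by (rule summable_norm[OF A'_sumn])
    also have "\<dots> \<le> w' u" unfolding w'_def
      by (rule suminf_le[OF A'_bd A'_sumn w'_sum])
    finally show ?thesis .
  qed
  have A'_good: "w' u * f u \<le> g u (A' u)" if u: "u \<in> S" for u
  proof -
    have bl: "bounded_linear (blinfun_apply (g u))" by (rule blinfun.bounded_linear_right)
    have s: "summable (\<lambda>n. g u ((1/2)^n *\<^sub>R A n u))"
      by (rule bounded_linear.summable[OF bl A'_sum])
    have "w' u * f u = (\<Sum>n. (1/2)^n * w n u * f u)"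
      unfolding w'_def by (rule suminf_mult2[OF w'_sum])
    also have "\<dots> \<le> (\<Sum>n. g u ((1/2)^n *\<^sub>R A n u))"
    proof (rule suminf_le[OF _ _ s])
      show "(1/2)^n * w n u * f u \<le> g u ((1/2)^n *\<^sub>R A n u)" for n
        using A_good[OF u, of n] by (simp add: blinfun.scaleR_right mult.assoc)
      show "summable (\<lambda>n. (1/2)^n * w n u * f u)" by (rule summable_mult2[OF w'_sum])
    qed
    also have "\<dots> = g u (A' u)" unfolding A'_def
      by (rule bounded_linear.suminf[OF bl A'_sum, symmetric])
    finally show ?thesis .
  qed
  show ?thesis
  proof (rule that[of "\<lambda>u. (1 / w' u) *\<^sub>R A' u"])
    show "continuous_on S (\<lambda>u. (1 / w' u) *\<^sub>R A' u)"
      using w'_pos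
      by (intro continuous_intros continuous_on_subset[OF w'_cont] continuous_on_subset[OF A'_cont])
         force+
    show "norm ((1 / w' y) *\<^sub>R A' y) \<le> 1" if "y \<in> S" for y
      using A'_norm[of y] w'_pos[OF that] by (simp add: field_simps)
    show "f y \<le> g y ((1 / w' y) *\<^sub>R A' y)" if "y \<in> S" for y
      using A'_good[OF that] w'_pos[OF that] by (simp add: blinfun.scaleR_right field_simps)
  qed
qed

section \<open>Odd descent steps\<close>

lemma derivative_of_even:
  assumes C1: "C1_functional I I'" and ev: "\<And>u. I (- u) = I u"
  shows "I' (- u) = - I' u"
proof -
  have m: "((\<lambda>u. - u) has_derivative (\<lambda>h. - h)) (at u)"
    by (intro derivative_intros)
  have "((\<lambda>u. I (- u)) has_derivative (\<lambda>h. I' (- u) (- h))) (at u)"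
    using C1 by (intro has_derivative_compose[OF m]) (simp add: C1_functional_def)
  then have "(I has_derivative (\<lambda>h. I' (- u) (- h))) (at u)"
    by (simp add: ev)
  moreover have "(I has_derivative blinfun_apply (I' u)) (at u)"
    using C1 by (simp add: C1_functional_def)
  ultimately have eq: "(\<lambda>h. I' (- u) (- h)) = blinfun_apply (I' u)"
    by (rule has_derivative_unique)
  have "I' (- u) h = - I' u h" for h
    using fun_cong[OF eq, of "- h"] by (simp add: blinfun.minus_right)
  then show ?thesis by (intro blinfun_eqI) (simp add: blinfun.minus_left)
qed

lemma C1_decrease_along_segment:
  assumes C1: "C1_functional I I'" and "0 \<le> s"
    and slope: "\<And>t. 0 \<le> t \<Longrightarrow> t \<le> s \<Longrightarrow> m \<le> I' (u - t *\<^sub>R v) v"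
  shows "I (u - s *\<^sub>R v) \<le> I u - s * m"
proof (cases "s = 0")
  case False
  then have "0 < s" using \<open>0 \<le> s\<close> by simp
  have "((\<lambda>t. I (u - t *\<^sub>R v)) has_real_derivative - I' (u - t *\<^sub>R v) v) (at t)" for t
  proof -
    have line: "((\<lambda>t. u - t *\<^sub>R v) has_derivative (\<lambda>h. - (h *\<^sub>R v))) (at t)"
      by (auto intro!: derivative_eq_intros)
    have "((\<lambda>t. I (u - t *\<^sub>R v)) has_derivative (\<lambda>h. I' (u - t *\<^sub>R v) (- (h *\<^sub>R v)))) (at t)"
      using C1 by (intro has_derivative_compose[OF line]) (simp add: C1_functional_def)
    then show ?thesis
      by (rule has_derivative_imp_has_field_derivative)
         (simp add: blinfun.minus_right blinfun.scaleR_right)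
  qed
  from MVT2[OF \<open>0 < s\<close> this]
  obtain z where z: "0 < z" "z < s" "I (u - s *\<^sub>R v) - I u = s * - I' (u - z *\<^sub>R v) v"
    by auto
  have "s * m \<le> s * I' (u - z *\<^sub>R v) v"
    using slope[of z] z \<open>0 < s\<close> by (intro mult_left_mono) auto
  then show ?thesis using z(3) unfolding mult_minus_right by linarith
qed simp

text \<open>
  A vector almost attaining the dual norm of \<open>g x\<close> still attains half of it for \<open>g y\<close> with \<open>y\<close>
  near \<open>x\<close>, which is the local input of the selection lemma. Since \<open>g\<close> is odd, averaging the field
  with its reflection makes it odd without losing the bound.
\<close>

lemma odd_pseudo_gradient:
  fixes g :: "'a::banach \<Rightarrow> 'a \<Rightarrow>\<^sub>L real"
  assumes g_cont: "continuous_on UNIV g" and g_odd: "\<And>u. g (- u) = - g u"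
  obtains V where "continuous_on {u. g u \<noteq> 0} V"
    and "\<And>u. g u \<noteq> 0 \<Longrightarrow> norm (V u) \<le> 1"
    and "\<And>u. g u \<noteq> 0 \<Longrightarrow> norm (g u) / 2 \<le> g u (V u)"
    and "\<And>u. g u \<noteq> 0 \<Longrightarrow> V (- u) = - V u"
proof -
  let ?R = "{u. g u \<noteq> 0}"
  have "\<exists>v r. norm v \<le> 1 \<and> r > 0 \<and> (\<forall>y\<in>?R. dist x y < r \<longrightarrow> norm (g y) / 2 \<le> g y v)"
    if x: "x \<in> ?R" for x
  proof -
    have "\<exists>v. norm v \<le> 1 \<and> norm (g x) / 2 < g x v"
    proof -
      have "\<not> (\<forall>v. norm (g x v) \<le> norm (g x) / 2 * norm v)"
      proof
        assume "\<forall>v. norm (g x v) \<le> norm (g x) / 2 * norm v"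
        then have "norm (g x) \<le> norm (g x) / 2"
          by (intro norm_blinfun_bound) auto
        then show False using x by simp
      qed
      then obtain v where v: "norm (g x) / 2 * norm v < \<bar>g x v\<bar>" by (auto simp: not_le)
      then have nv: "norm v > 0" by auto
      define z where "z = (sgn (g x v) / norm v) *\<^sub>R v"
      have "norm z \<le> 1" using nv by (simp add: z_def sgn_if)
      moreover have "g x z = \<bar>g x v\<bar> / norm v"
        by (simp add: z_def blinfun.scaleR_right sgn_if)
      moreover have "norm (g x) / 2 < \<bar>g x v\<bar> / norm v"
        using v nv by (simp only: pos_less_divide_eq)
      ultimately show ?thesis by auto
    qed
    then obtain v where v: "norm v \<le> 1" "norm (g x) / 2 < g x v" by blast
    have "open {y. norm (g y) / 2 < g y v}"
      by (intro open_Collect_less continuous_intros g_cont) auto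
    then obtain r where "r > 0" "\<forall>y. dist y x < r \<longrightarrow> norm (g y) / 2 < g y v"
      using v unfolding open_dist by blast
    then show ?thesis using v(1) by (metis dist_commute less_imp_le)
  qed
  then obtain V0 where V0: "continuous_on ?R V0" "\<And>u. u \<in> ?R \<Longrightarrow> norm (V0 u) \<le> 1"
    "\<And>u. u \<in> ?R \<Longrightarrow> norm (g u) / 2 \<le> g u (V0 u)"
    using continuous_selection_half_spaces[of ?R "\<lambda>y. norm (g y) / 2" g] by blast
  define V where "V u = (1/2) *\<^sub>R (V0 u - V0 (- u))" for u
  show ?thesis
  proof
    have "continuous_on ?R (\<lambda>u. V0 (- u))"
      by (rule continuous_on_compose2[OF V0(1)]) (auto intro!: continuous_intros simp: g_odd)
    then show "continuous_on ?R V" unfolding V_def by (intro continuous_intros V0)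
    fix u assume u: "g u \<noteq> 0"
    have "norm (V0 u - V0 (- u)) \<le> norm (V0 u) + norm (V0 (- u))" by (rule norm_triangle_ineq4)
    also have "\<dots> \<le> 2" using V0(2)[of u] V0(2)[of "- u"] u by (simp add: g_odd)
    finally show "norm (V u) \<le> 1" by (simp add: V_def)
    have "norm (g u) / 2 \<le> g u (V0 u)" "norm (g u) / 2 \<le> - g u (V0 (- u))"
      using V0(3)[of u] V0(3)[of "- u"] u by (auto simp: g_odd blinfun.minus_left)
    then show "norm (g u) / 2 \<le> g u (V u)"
      by (simp add: V_def blinfun.scaleR_right blinfun.diff_right)
    show "V (- u) = - V u" by (simp add: V_def flip: scaleR_minus_right)
  qed
qed

lemma infdist_minus_symmetric:
  fixes S :: "'a::real_normed_vector set"
  assumes "\<And>x. x \<in> S \<Longrightarrow> - x \<in> S"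
  shows "infdist (- u) S = infdist u S"
proof -
  have *: "infdist (- v) S \<le> infdist v S" for v
  proof (cases "S = {}")
    case False
    have "infdist (- v) S \<le> dist v x" if "x \<in> S" for x
    proof -
      have "infdist (- v) S \<le> dist (- v) (- x)" using that assms by (intro infdist_le) auto
      also have "\<dots> = dist v x" by (simp add: dist_norm norm_minus_commute)
      finally show ?thesis .
    qed
    then show ?thesis using False by (subst (2) infdist_def) (auto intro!: cINF_greatest)
  qed (simp add: infdist_def)
  show ?thesis using *[of u] *[of "- u"] by simp
qed

text \<open>
  A single step of a discrete descent replaces the flow of the pseudo-gradient: \<open>I'\<close> is merely
  continuous, so a fixed field \<open>V\<close> decreases \<open>I\<close> only along a segment whose admissible length
  depends on the point. That length \<open>\<sigma>\<close> has to be continuous, even, and positive off the critical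
  points. All this is achieved by the distance in \<open>X \<times> X\<close> from \<open>(u, u)\<close> to the set of pairs
  \<open>(w, w')\<close> at which \<open>I' w\<close> fails to be large in the direction \<open>V w'\<close>: moving from \<open>u\<close> by less
  than this distance stays among the good points. As \<open>\<sigma>\<close> vanishes at critical points, the
  step \<open>W = \<sigma> V\<close> extends continuously to them.
\<close>

lemma odd_descent_step:
  fixes I :: "'a::banach \<Rightarrow> real"
  assumes C1: "C1_functional I I'" and ev: "\<And>u. I (- u) = I u" and \<kappa>: "\<kappa> > 0"
  obtains \<sigma> W where "continuous_on UNIV \<sigma>" and "continuous_on UNIV W"
    and "\<And>u. W (- u) = - W u"
    and "\<And>u. 0 \<le> \<sigma> u" and "\<And>u. \<sigma> u \<le> \<kappa>" and "\<And>u. I' u \<noteq> 0 \<Longrightarrow> 0 < \<sigma> u"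
    and "\<And>u. norm (W u) \<le> \<sigma> u"
    and "\<And>u t. 0 \<le> t \<Longrightarrow> t \<le> 1 \<Longrightarrow> I (u - t *\<^sub>R W u) \<le> I u - t * \<sigma> u * norm (I' u) / 4"
proof -
  let ?R = "{u. I' u \<noteq> 0}"
  have c: "continuous_on UNIV I'" using C1 by (simp add: C1_functional_def)
  have od: "I' (- u) = - I' u" for u by (rule derivative_of_even[OF C1 ev])
  have I'0: "I' 0 = 0"
  proof -
    have "I' 0 h = 0" for h
      using od[of 0] blinfun.minus_left[of "I' 0" h] by simp
    then show ?thesis by (intro blinfun_eqI) simp
  qed
  obtain V where Vc: "continuous_on ?R V" and V1: "\<And>u. u \<in> ?R \<Longrightarrow> norm (V u) \<le> 1"
    and Vg: "\<And>u. u \<in> ?R \<Longrightarrow> norm (I' u) / 2 \<le> I' u (V u)"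
    and Vo: "\<And>u. u \<in> ?R \<Longrightarrow> V (- u) = - V u"
    using odd_pseudo_gradient[OF c od] by auto
  define G where "G = {p \<in> UNIV \<times> ?R. norm (I' (snd p)) / 4 < I' (fst p) (V (snd p))}"
  have openR: "open ?R"
    by (intro open_Collect_neq c continuous_intros)
  have openG: "open G"
  proof -
    have 1: "continuous_on (UNIV \<times> ?R) (\<lambda>p. I' (fst p))"
      by (rule continuous_on_compose2[OF c]) (auto intro!: continuous_intros)
    have 2: "continuous_on (UNIV \<times> ?R) (\<lambda>p. I' (snd p))"
      by (rule continuous_on_compose2[OF c]) (auto intro!: continuous_intros)
    have 3: "continuous_on (UNIV \<times> ?R) (\<lambda>p. V (snd p))"
      by (rule continuous_on_compose2[OF Vc]) (auto intro!: continuous_intros)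
    have "continuous_on (UNIV \<times> ?R) (\<lambda>p. I' (fst p) (V (snd p)) - norm (I' (snd p)) / 4)"
      by (intro continuous_intros 1 2 3) auto
    from continuous_open_preimage[OF this _ open_greaterThan[of 0]]
    have "open ((UNIV \<times> ?R) \<inter> (\<lambda>p. I' (fst p) (V (snd p)) - norm (I' (snd p)) / 4) -` {0<..})"
      using openR by (auto intro: open_Times)
    moreover have "(UNIV \<times> ?R) \<inter> (\<lambda>p. I' (fst p) (V (snd p)) - norm (I' (snd p)) / 4) -` {0<..} = G"
      by (auto simp: G_def)
    ultimately show ?thesis by simp
  qed
  have Gsym: "- p \<in> G \<longleftrightarrow> p \<in> G" for p
    by (cases p) (auto simp: G_def od Vo blinfun.minus_left blinfun.minus_right)
  have "(0, 0) \<in> - G" by (simp add: G_def I'0)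
  then have ne: "- G \<noteq> {}" by blast
  define \<rho> where "\<rho> u = infdist (u, u) (- G)" for u
  have \<rho>_even: "\<rho> (- u) = \<rho> u" for u
    using infdist_minus_symmetric[of "- G" "(u, u)"] Gsym by (simp add: \<rho>_def)
  have \<rho>_pos: "\<rho> u > 0" if "u \<in> ?R" for u
  proof -
    have "0 < norm (I' u)" using that by simp
    then have "norm (I' u) / 4 < I' u (V u)" using Vg[OF that] by linarith
    then have "(u, u) \<in> G" using that by (simp add: G_def)
    then have "(u, u) \<notin> - G" by simp
    moreover have "closed (- G)" using openG by (simp add: closed_def)
    ultimately show ?thesis using ne unfolding \<rho>_def
      by (metis in_closed_iff_infdist_zero infdist_nonneg less_eq_real_def)
  qed
  have \<rho>_crit: "\<rho> u = 0" if "u \<notin> ?R" for u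
    using that by (auto simp: \<rho>_def G_def intro!: infdist_zero)
  define \<sigma> where "\<sigma> u = min \<kappa> (\<rho> u / 2)" for u
  have \<rho>_cont: "continuous_on UNIV \<rho>" unfolding \<rho>_def by (intro continuous_intros)
  have \<sigma>_cont: "continuous_on UNIV \<sigma>"
    unfolding \<sigma>_def using \<rho>_cont by (intro continuous_intros) auto
  have \<sigma>0: "0 \<le> \<sigma> u" for u using \<kappa> by (simp add: \<sigma>_def \<rho>_def infdist_nonneg)
  have \<sigma>_crit: "\<sigma> u = 0" if "u \<notin> ?R" for u using \<rho>_crit[OF that] \<kappa> by (simp add: \<sigma>_def)
  have \<sigma>_pos: "0 < \<sigma> u" if "u \<in> ?R" for u using \<rho>_pos[OF that] \<kappa> by (simp add: \<sigma>_def)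
  define W where "W u = \<sigma> u *\<^sub>R V u" for u
  have W_norm: "norm (W u) \<le> \<sigma> u" for u
  proof (cases "u \<in> ?R")
    case True
    then show ?thesis using V1[OF True] \<sigma>0[of u] by (simp add: W_def mult_left_le)
  next
    case False
    then show ?thesis by (simp add: W_def \<sigma>_crit)
  qed
  show ?thesis
  proof
    show "continuous_on UNIV \<sigma>" by (rule \<sigma>_cont)
    show "continuous_on UNIV W"
      unfolding continuous_on_eq_continuous_at[OF open_UNIV]
    proof
      fix u
      have \<sigma>u: "isCont \<sigma> u" using \<sigma>_cont by (simp add: continuous_on_eq_continuous_at)
      show "isCont W u"
      proof (cases "u \<in> ?R")
        case True
        then have "isCont V u"
          using Vc openR by (simp add: continuous_on_eq_continuous_at)
        with \<sigma>u show ?thesis unfolding W_def by (intro continuous_intros)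
      next
        case False
        have "(\<sigma> \<longlongrightarrow> 0) (at u)" using \<sigma>u \<sigma>_crit[OF False] by (simp add: isCont_def)
        then have "(W \<longlongrightarrow> 0) (at u)"
          by (rule Lim_null_comparison[rotated]) (use W_norm in simp)
        moreover have "W u = 0" using \<sigma>_crit[OF False] by (simp add: W_def)
        ultimately show ?thesis by (simp add: isCont_def)
      qed
    qed
    show "W (- u) = - W u" for u
    proof (cases "u \<in> ?R")
      case True
      then show ?thesis by (simp add: W_def \<sigma>_def \<rho>_even Vo)
    next
      case False
      then show ?thesis by (simp add: W_def \<sigma>_crit od)
    qed
    show "0 \<le> \<sigma> u" "\<sigma> u \<le> \<kappa>" for u using \<sigma>0 by (auto simp: \<sigma>_def)
    show "0 < \<sigma> u" if "I' u \<noteq> 0" for u using \<sigma>_pos that by simp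
    show "norm (W u) \<le> \<sigma> u" for u by (rule W_norm)
    show "I (u - t *\<^sub>R W u) \<le> I u - t * \<sigma> u * norm (I' u) / 4" if t: "0 \<le> t" "t \<le> 1" for u t
    proof (cases "u \<in> ?R")
      case True
      have "norm (I' u) / 4 \<le> I' (u - s *\<^sub>R V u) (V u)" if s: "0 \<le> s" "s \<le> t * \<sigma> u" for s
      proof -
        have "s \<le> \<sigma> u" using s t \<sigma>0[of u] by (smt (verit) mult_left_le_one_le)
        also have "\<dots> < \<rho> u" using \<rho>_pos[OF True] by (simp add: \<sigma>_def)
        finally have "s < \<rho> u" .
        moreover have "dist (u, u) (u - s *\<^sub>R V u, u) \<le> s"
          using s V1[OF True] by (simp add: dist_prod_def dist_norm mult_left_le)
        ultimately have "(u - s *\<^sub>R V u, u) \<notin> - G"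
          unfolding \<rho>_def by (metis infdist_le leD order_trans)
        then show ?thesis by (simp add: G_def)
      qed
      from C1_decrease_along_segment[OF C1 _ this] show ?thesis
        using t \<sigma>0[of u] by (simp add: W_def)
    next
      case False
      then show ?thesis by (simp add: W_def \<sigma>_crit)
    qed
  qed
qed

section \<open>Odd deformations of sublevel sets\<close>

text \<open>
  The function \<open>e\<close> measures closeness to a dangerous set, where nothing is known about the gradient
  (\<open>e > 3 s\<close>). An orbit that starts in \<open>e \<le> 2 s\<close> cannot enter it above the level \<open>a\<close>:
  crossing \<open>2 s \<le> e \<le> 3 s\<close> takes a total step length of at least \<open>s\<close>, because \<open>e\<close> is 1-Lipschitz, and
  costs at least \<open>\<delta>' s / 4\<close> in energy, which is more than the height of the band. The bound
  \<open>\<delta>\<close> may be much smaller than \<open>\<delta>'\<close>; it serves to show that an orbit staying above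
  \<open>a\<close> has summable step lengths, hence converges to a point where \<open>\<sigma>\<close> is both zero and positive.
\<close>

lemma descent_below_level:
  fixes I :: "'a::banach \<Rightarrow> real" and W :: "'a \<Rightarrow> 'a" and x :: "nat \<Rightarrow> 'a"
  assumes I_cont: "continuous_on UNIV I" and e_cont: "continuous_on UNIV e"
    and \<sigma>_cont: "continuous_on UNIV \<sigma>"
    and e_lip: "\<And>u v. \<bar>e u - e v\<bar> \<le> norm (u - v)"
    and \<sigma>0: "\<And>u. 0 \<le> \<sigma> u" and \<sigma>s: "\<And>u. \<sigma> u \<le> s" and \<sigma>pos: "\<And>u. I' u \<noteq> 0 \<Longrightarrow> 0 < \<sigma> u"
    and W: "\<And>u. norm (W u) \<le> \<sigma> u"
    and desc: "\<And>u. I (u - W u) \<le> I u - \<sigma> u * norm (I' u) / 4"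
    and s: "s > 0" and \<delta>: "\<delta> > 0" and \<delta>': "\<delta>' > 0"
    and grad: "\<And>u. a \<le> I u \<Longrightarrow> I u \<le> b \<Longrightarrow> e u \<le> 3 * s \<Longrightarrow> \<delta> \<le> norm (I' u)"
    and grad': "\<And>u. a \<le> I u \<Longrightarrow> I u \<le> b \<Longrightarrow> s \<le> e u \<Longrightarrow> e u \<le> 3 * s \<Longrightarrow> \<delta>' \<le> norm (I' u)"
    and ab: "b - a < \<delta>' * s / 4"
    and x_step: "\<And>n. x (Suc n) = x n - W (x n)"
    and x0: "I (x 0) \<le> b" "e (x 0) \<le> 2 * s"
  shows "\<exists>n. I (x n) < a"
proof (rule ccontr)
  assume "\<not> ?thesis"
  then have above: "a \<le> I (x n)" for n by (auto simp: not_less)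
  have dist_step: "norm (x (Suc n) - x n) \<le> \<sigma> (x n)" for n
    using W[of "x n"] by (simp add: x_step)
  \<comment> \<open>The energy already spent pays for the depth reached beyond \<open>e = 2 s\<close>; points with \<open>e < s\<close> are not
    charged because one step, of length at most \<open>s\<close>, leaves them below \<open>2 s\<close>.\<close>
  have inv: "I (x n) \<le> b - \<delta>' / 4 * max 0 (e (x n) - 2 * s) \<and> e (x n) \<le> 3 * s" for n
  proof (induction n)
    case 0
    then show ?case using x0 s by (simp add: max_def)
  next
    case (Suc n)
    have nn: "\<delta>' / 4 * max 0 (e (x n) - 2 * s) \<ge> 0" using \<delta>' by simp
    then have Ib: "I (x n) \<le> b" using Suc by linarith
    have dr: "I (x (Suc n)) \<le> I (x n) - \<sigma> (x n) * norm (I' (x n)) / 4"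
      using desc[of "x n"] by (simp add: x_step)
    have en: "e (x (Suc n)) \<le> e (x n) + \<sigma> (x n)"
      using e_lip[of "x (Suc n)" "x n"] dist_step[of n] by linarith
    have *: "I (x (Suc n)) \<le> b - \<delta>' / 4 * max 0 (e (x (Suc n)) - 2 * s)"
    proof (cases "s \<le> e (x n)")
      case True
      have "\<sigma> (x n) * \<delta>' \<le> \<sigma> (x n) * norm (I' (x n))"
        using grad'[OF above Ib True] Suc \<sigma>0 by (intro mult_left_mono) auto
      moreover have "\<delta>' / 4 * max 0 (e (x (Suc n)) - 2 * s) \<le> \<delta>' / 4 * (max 0 (e (x n) - 2 * s) + \<sigma> (x n))"
        using en \<delta>' \<sigma>0[of "x n"] by (intro mult_left_mono) auto
      ultimately show ?thesis using dr Suc by (simp add: algebra_simps)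
    next
      case False
      then have "e (x (Suc n)) \<le> 2 * s" using en \<sigma>s[of "x n"] by linarith
      moreover have "0 \<le> \<sigma> (x n) * norm (I' (x n))" using \<sigma>0 by simp
      ultimately show ?thesis using dr Ib by simp
    qed
    have "e (x (Suc n)) \<le> 3 * s"
    proof (rule ccontr)
      assume "\<not> ?thesis"
      then have "s \<le> max 0 (e (x (Suc n)) - 2 * s)" by simp
      then have "\<delta>' / 4 * s \<le> \<delta>' / 4 * max 0 (e (x (Suc n)) - 2 * s)"
        using \<delta>' by (intro mult_left_mono) auto
      then show False using * above[of "Suc n"] ab by simp
    qed
    with * show ?case by blast
  qed
  have Ib: "I (x n) \<le> b" for n
  proof -
    have "\<delta>' / 4 * max 0 (e (x n) - 2 * s) \<ge> 0" using \<delta>' by simp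
    then show ?thesis using inv[of n] by linarith
  qed
  have drop: "\<delta> / 4 * \<sigma> (x n) \<le> I (x n) - I (x (Suc n))" for n
  proof -
    have "\<sigma> (x n) * \<delta> \<le> \<sigma> (x n) * norm (I' (x n))"
      using grad[OF above Ib] inv \<sigma>0 by (intro mult_left_mono) auto
    then show ?thesis using desc[of "x n"] by (simp add: x_step algebra_simps)
  qed
  have "(\<Sum>n<N. \<sigma> (x n)) \<le> 4 / \<delta> * (b - a)" for N
  proof -
    have "\<delta> / 4 * (\<Sum>n<N. \<sigma> (x n)) \<le> (\<Sum>n<N. I (x n) - I (x (Suc n)))"
      unfolding sum_distrib_left by (intro sum_mono drop)
    also have "\<dots> = I (x 0) - I (x N)" by (rule sum_lessThan_telescope')
    also have "\<dots> \<le> b - a" using above[of N] x0 by linarith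
    finally show ?thesis using \<delta> by (simp add: field_simps)
  qed
  then have \<sigma>sum: "summable (\<lambda>n. \<sigma> (x n))"
    by (intro bounded_imp_summable[where B="4 / \<delta> * (b - a)"]) (use \<sigma>0 in \<open>simp_all only: flip: lessThan_Suc_atMost\<close>)
  then have "summable (\<lambda>n. norm (x (Suc n) - x n))"
    by (rule summable_comparison_test'[where N=0]) (use dist_step in simp)
  then have "summable (\<lambda>n. x (Suc n) - x n)" by (rule summable_norm_cancel)
  then have "convergent (\<lambda>n. x n - x 0)"
    by (simp add: summable_iff_convergent sum_lessThan_telescope)
  then obtain l' where "(\<lambda>n. x n - x 0) \<longlonglongrightarrow> l'" by (auto simp: convergent_def)
  from tendsto_add[OF this tendsto_const[of "x 0"]]
  obtain l where l: "x \<longlonglongrightarrow> l" by auto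
  have lim: "(\<lambda>n. f (x n)) \<longlonglongrightarrow> f l" if "continuous_on UNIV f" for f :: "'a \<Rightarrow> real"
    by (rule continuous_on_tendsto_compose[OF that l]) auto
  have "\<delta> \<le> norm (I' l)"
  proof (rule grad)
    show "a \<le> I l" by (rule LIMSEQ_le_const[OF lim[OF I_cont]]) (use above in blast)
    show "I l \<le> b" by (rule LIMSEQ_le_const2[OF lim[OF I_cont]]) (use Ib in blast)
    show "e l \<le> 3 * s" by (rule LIMSEQ_le_const2[OF lim[OF e_cont]]) (use inv in blast)
  qed
  then have "0 < \<sigma> l" using \<delta> by (intro \<sigma>pos) auto
  moreover have "\<sigma> l = 0"
    using LIMSEQ_unique[OF lim[OF \<sigma>_cont] summable_LIMSEQ_zero[OF \<sigma>sum]] .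
  ultimately show False by simp
qed

text \<open>
  Each point reaches the region \<open>I < a\<close> after finitely many steps, but their number jumps with the
  point. The damping factor makes the stopping continuous: it is \<open>1\<close> as long as the orbit
  is not yet below \<open>a\<close>, and near every point that gets there it vanishes for all large \<open>n\<close>, so that
  the iterates are locally eventually constant.
\<close>

fun damped_iterates :: "('a::real_normed_vector \<Rightarrow> real) \<Rightarrow> ('a \<Rightarrow> 'a) \<Rightarrow> real \<Rightarrow> nat \<Rightarrow> 'a \<Rightarrow> 'a" where
  "damped_iterates I W a 0 u = u"
| "damped_iterates I W a (Suc n) u =
     damped_iterates I W a n u -
       max 0 (1 - real n * infdist u {v. a \<le> I (damped_iterates I W a n v)})
         *\<^sub>R W (damped_iterates I W a n u)"

text \<open>
  The deformation is the pointwise limit of the damped iterates, which is locally attained after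
  finitely many steps and therefore inherits continuity and oddness. Since \<open>a \<le> 0 = I 0\<close> and odd
  maps fix \<open>0\<close>, the origin never drops below \<open>a\<close>; thus the closed sets in the damping factors
  are nonempty and their \<open>infdist\<close> is a genuine distance.
\<close>

lemma odd_deformation:
  fixes I :: "'a::banach \<Rightarrow> real"
  assumes C1: "C1_functional I I'" and I0: "I 0 = 0" and ev: "\<And>u. I (- u) = I u"
    and a: "a \<le> 0"
    and e_lip: "\<And>u v. \<bar>e u - e v\<bar> \<le> norm (u - v)"
    and s: "s > 0" and \<delta>: "\<delta> > 0" and \<delta>': "\<delta>' > 0"
    and grad: "\<And>u. a \<le> I u \<Longrightarrow> I u \<le> b \<Longrightarrow> e u \<le> 3 * s \<Longrightarrow> \<delta> \<le> norm (I' u)"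
    and grad': "\<And>u. a \<le> I u \<Longrightarrow> I u \<le> b \<Longrightarrow> s \<le> e u \<Longrightarrow> e u \<le> 3 * s \<Longrightarrow> \<delta>' \<le> norm (I' u)"
    and ab: "b - a < \<delta>' * s / 4"
  obtains G where "continuous_on {u. I u \<le> b \<and> e u \<le> 2 * s} G"
    and "\<And>u. I u \<le> b \<Longrightarrow> e u \<le> 2 * s \<Longrightarrow> I (G u) \<le> a"
    and "\<And>u. I u \<le> b \<Longrightarrow> e u \<le> 2 * s \<Longrightarrow> G (- u) = - G u"
proof -
  have I_cont: "continuous_on UNIV I"
    using C1 by (auto simp: C1_functional_def intro!: has_derivative_continuous_on)
  have e_cont: "continuous_on UNIV e"
    unfolding continuous_on_iff using e_lip by (metis dist_norm le_less_trans real_norm_def)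
  obtain \<sigma> W where \<sigma>_cont: "continuous_on UNIV \<sigma>" and W_cont: "continuous_on UNIV W"
    and W_odd: "\<And>u. W (- u) = - W u"
    and \<sigma>: "\<And>u. 0 \<le> \<sigma> u" "\<And>u. \<sigma> u \<le> s" "\<And>u. I' u \<noteq> 0 \<Longrightarrow> 0 < \<sigma> u" "\<And>u. norm (W u) \<le> \<sigma> u"
    and desc: "\<And>u t. 0 \<le> t \<Longrightarrow> t \<le> 1 \<Longrightarrow> I (u - t *\<^sub>R W u) \<le> I u - t * \<sigma> u * norm (I' u) / 4"
    using odd_descent_step[OF C1 ev s] by blast
  let ?g = "damped_iterates I W a"
  define S where "S n = {v. a \<le> I (?g n v)}" for n
  define \<theta> where "\<theta> n u = max 0 (1 - real n * infdist u (S n))" for n u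
  have gSuc: "?g (Suc n) u = ?g n u - \<theta> n u *\<^sub>R W (?g n u)" for n u
    by (simp add: \<theta>_def S_def)
  have \<theta>01: "0 \<le> \<theta> n u" "\<theta> n u \<le> 1" for n u
    by (auto simp: \<theta>_def infdist_nonneg)
  have \<theta>1: "\<theta> n u = 1" if "u \<in> S n" for n u using that by (simp add: \<theta>_def)
  have g_odd: "?g n (- u) = - ?g n u" for n u
  proof (induction n arbitrary: u)
    case (Suc n)
    have "infdist (- u) (S n) = infdist u (S n)"
      by (rule infdist_minus_symmetric) (simp add: S_def Suc.IH ev)
    then have "\<theta> n (- u) = \<theta> n u" by (simp add: \<theta>_def)
    then show ?case unfolding gSuc Suc.IH W_odd by simp
  qed simp
  have g_cont: "continuous_on UNIV (?g n)" for n
  proof (induction n)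
    case (Suc n)
    have "continuous_on UNIV (\<theta> n)" unfolding \<theta>_def by (intro continuous_intros)
    moreover have "continuous_on UNIV (\<lambda>u. W (?g n u))"
      by (rule continuous_on_compose2[OF W_cont Suc.IH]) auto
    ultimately have "continuous_on UNIV (\<lambda>u. ?g n u - \<theta> n u *\<^sub>R W (?g n u))"
      by (intro continuous_intros Suc.IH)
    then show ?case by (simp only: gSuc)
  qed (simp add: continuous_on_id)
  have g_dec1: "I (?g (Suc n) u) \<le> I (?g n u)" for n u
  proof -
    have "0 \<le> \<theta> n u * \<sigma> (?g n u) * norm (I' (?g n u)) / 4" using \<theta>01 \<sigma> by simp
    then show ?thesis unfolding gSuc using desc[OF \<theta>01, of "?g n u" n u] by linarith
  qed
  have S_anti: "S n \<subseteq> S m" if "m \<le> n" for m n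
    using lift_Suc_antimono_le[of "\<lambda>n. I (?g n u)" for u, OF g_dec1 that]
    by (auto simp: S_def intro: order_trans)
  have S_closed: "closed (S n)" for n
    unfolding S_def
    by (intro closed_Collect_le continuous_intros continuous_on_compose2[OF I_cont g_cont]) auto
  have zero_S: "0 \<in> S n" for n
  proof -
    have "?g n 0 = - ?g n 0" using g_odd[of n 0] by simp
    then have "2 *\<^sub>R ?g n 0 = 0" by (metis add.right_inverse scaleR_2)
    then show ?thesis by (simp add: S_def I0 a)
  qed
  have leaves: "\<exists>n. u \<notin> S n" if u: "I u \<le> b" "e u \<le> 2 * s" for u
  proof (rule ccontr)
    assume "\<not> ?thesis"
    then have uS: "u \<in> S n" for n by blast
    have "\<exists>n. I (?g n u) < a"
    proof (rule descent_below_level[where I=I and e=e and \<sigma>=\<sigma> and I'=I' and W=W and a=a and b=b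
          and s=s and \<delta>=\<delta> and \<delta>'=\<delta>' and x="\<lambda>n. ?g n u"])
      show "I (v - W v) \<le> I v - \<sigma> v * norm (I' v) / 4" for v
        using desc[of 1 v] by simp
      show "?g (Suc n) u = ?g n u - W (?g n u)" for n
        unfolding gSuc using \<theta>1[OF uS] by simp
    qed (use assms \<sigma> I_cont e_cont \<sigma>_cont u in auto)
    then show False using uS by (auto simp: S_def not_le[symmetric])
  qed
  have stable: "\<exists>N d. d > 0 \<and> (\<forall>v n. dist v u < d \<longrightarrow> N \<le> n \<longrightarrow> ?g n v = ?g N v) \<and> I (?g N u) < a"
    if u: "I u \<le> b" "e u \<le> 2 * s" for u
  proof -
    obtain m where m: "u \<notin> S m" using leaves[OF u] by blast
    define \<eta> where "\<eta> = infdist u (S m)"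
    have \<eta>: "\<eta> > 0" unfolding \<eta>_def
      using m S_closed zero_S by (metis empty_iff in_closed_iff_infdist_zero infdist_nonneg less_eq_real_def)
    obtain k :: nat where k: "2 / \<eta> \<le> k" using real_arch_simple by blast
    define N where "N = max m k"
    have zero: "\<theta> n v = 0" if v: "dist v u < \<eta> / 2" and n: "N \<le> n" for n v
    proof -
      have "\<eta> \<le> infdist v (S m) + dist u v" unfolding \<eta>_def by (rule infdist_triangle)
      also have "infdist v (S m) \<le> infdist v (S n)"
        using n zero_S by (intro infdist_mono S_anti) (auto simp: N_def)
      finally have "\<eta> / 2 \<le> infdist v (S n)" using v by (simp add: dist_commute)
      moreover have "2 / \<eta> \<le> real n" using k n by (simp add: N_def)
      ultimately have "2 / \<eta> * (\<eta> / 2) \<le> real n * infdist v (S n)"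
        using \<eta> by (intro mult_mono) auto
      then show ?thesis using \<eta> by (simp add: \<theta>_def)
    qed
    have "?g n v = ?g N v" if v: "dist v u < \<eta> / 2" and n: "N \<le> n" for n v
      using n by (induction n rule: dec_induct) (simp_all del: damped_iterates.simps add: gSuc zero[OF v])
    moreover have "I (?g N u) < a"
      using m S_anti[of m N] unfolding S_def N_def by (meson max.cobounded1 mem_Collect_eq not_le subsetD)
    moreover have "\<eta> / 2 > 0" using \<eta> by simp
    ultimately show ?thesis by blast
  qed
  define G where "G u = lim (\<lambda>n. ?g n u)" for u
  have G_eq: "G v = ?g N v" if "\<And>n. N \<le> n \<Longrightarrow> ?g n v = ?g N v" for v N
  proof -
    have "(\<lambda>n. ?g n v) \<longlonglongrightarrow> ?g N v"
      by (rule tendsto_eventually[OF eventually_sequentiallyI[of N]]) (rule that)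
    then show ?thesis unfolding G_def by (rule limI)
  qed
  show ?thesis
  proof
    show "continuous_on {u. I u \<le> b \<and> e u \<le> 2 * s} G"
    proof (rule continuous_at_imp_continuous_on, rule ballI)
      fix u assume "u \<in> {u. I u \<le> b \<and> e u \<le> 2 * s}"
      then obtain N d where d: "d > 0" and N: "\<And>v n. dist v u < d \<Longrightarrow> N \<le> n \<Longrightarrow> ?g n v = ?g N v"
        using stable by blast
      have eq: "G v = ?g N v" if "dist v u < d" for v
        by (rule G_eq) (rule N[OF that])
      have "isCont (?g N) u" using g_cont[of N] by (simp add: continuous_on_eq_continuous_at)
      then show "isCont G u"
        by (rule continuous_transform_within[OF _ d]) (auto simp: eq)
    qed
    fix u assume u: "I u \<le> b" "e u \<le> 2 * s"
    obtain N d where d: "d > 0" and N: "\<And>v n. dist v u < d \<Longrightarrow> N \<le> n \<Longrightarrow> ?g n v = ?g N v"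
      and below: "I (?g N u) < a"
      using stable[OF u] by blast
    have fixed: "?g n u = ?g N u" if "N \<le> n" for n
      by (rule N[OF _ that]) (simp add: d)
    have Gu: "G u = ?g N u" by (rule G_eq) (rule fixed)
    show "I (G u) \<le> a" using below by (simp add: Gu)
    have "?g n (- u) = ?g N (- u)" if "N \<le> n" for n unfolding g_odd fixed[OF that] ..
    then have "G (- u) = ?g N (- u)" by (rule G_eq)
    then show "G (- u) = - G u" by (simp add: Gu g_odd)
  qed
qed

section \<open>Odd maps into punctured Euclidean spaces\<close>

lemma odd_map_to_punctured_iff:
  "odd_map_to_punctured A n \<zeta> \<longleftrightarrow>
     (\<forall>i. continuous_on A (\<lambda>u. \<zeta> u i)) \<and>
     (\<forall>u\<in>A. (\<forall>i\<ge>n. \<zeta> u i = 0) \<and> (\<exists>i. \<zeta> u i \<noteq> 0) \<and> (\<forall>i. \<zeta> (- u) i = - \<zeta> u i))"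
  unfolding odd_map_to_punctured_def Euclidean_space_def
  by (auto simp: continuous_map_in_subtopology continuous_map_componentwise_UNIV image_subset_iff
      Pi_iff fun_eq_iff)

lemma odd_map_to_punctured_subset:
  assumes "odd_map_to_punctured A n \<zeta>" "B \<subseteq> A"
  shows "odd_map_to_punctured B n \<zeta>"
  using assms unfolding odd_map_to_punctured_iff by (blast intro: continuous_on_subset)

lemma odd_map_to_punctured_compose:
  assumes \<zeta>: "odd_map_to_punctured B n \<zeta>" and G: "continuous_on A G" "G ` A \<subseteq> B"
    and odd: "\<And>u. u \<in> A \<Longrightarrow> G (- u) = - G u"
  shows "odd_map_to_punctured A n (\<lambda>u. \<zeta> (G u))"
  using \<zeta> G odd unfolding odd_map_to_punctured_iff
  by (auto intro: continuous_on_compose2)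

text \<open>
  Subadditivity of the genus: the two odd maps are concatenated. The map \<open>\<xi>\<close> is only defined
  where \<open>e \<le> t\<close>; the factor \<open>t - e\<close> extends it continuously by zero, and where this
  factor vanishes \<open>\<mu>\<close> takes over.
\<close>

lemma odd_map_to_punctured_union:
  fixes e :: "'a::real_normed_vector \<Rightarrow> real" and \<mu> :: "'a \<Rightarrow> nat \<Rightarrow> real"
  assumes \<xi>: "odd_map_to_punctured {u \<in> A. e u \<le> t} p \<xi>"
    and e_cont: "continuous_on A e" and e_even: "\<And>u. e (- u) = e u"
    and \<mu>_cont: "\<And>i. continuous_on A (\<lambda>u. \<mu> u i)" and \<mu>_odd: "\<And>u i. \<mu> (- u) i = - \<mu> u i"
    and \<mu>_dim: "\<And>u i. m \<le> i \<Longrightarrow> \<mu> u i = 0"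
    and \<mu>_nz: "\<And>u. u \<in> A \<Longrightarrow> t \<le> e u \<Longrightarrow> \<exists>i. \<mu> u i \<noteq> 0"
  shows "\<exists>\<zeta>. odd_map_to_punctured A (p + m) \<zeta>"
proof -
  define \<zeta> where "\<zeta> u i = (if i < p then if e u \<le> t then (t - e u) * \<xi> u i else 0 else \<mu> u (i - p))"
    for u i
  have \<xi>c: "continuous_on {u \<in> A. e u \<le> t} (\<lambda>u. \<xi> u i)" for i
    using \<xi> by (simp add: odd_map_to_punctured_iff)
  have "continuous_on A (\<lambda>u. \<zeta> u i)" for i
  proof (cases "i < p")
    case True
    have "continuous_on A (\<lambda>u. if e u \<le> t then (t - e u) * \<xi> u i else 0)"
      by (intro continuous_on_cases_le continuous_intros \<xi>c continuous_on_subset[OF e_cont] e_cont) auto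
    then show ?thesis using True by (simp add: \<zeta>_def)
  next
    case False
    then show ?thesis using \<mu>_cont by (simp add: \<zeta>_def)
  qed
  moreover have "\<exists>i. \<zeta> u i \<noteq> 0" if u: "u \<in> A" for u
  proof (cases "e u < t")
    case True
    then have uu: "u \<in> {u \<in> A. e u \<le> t}" using u by simp
    then obtain i where "\<xi> u i \<noteq> 0" using \<xi> unfolding odd_map_to_punctured_iff by blast
    moreover have "i < p"
      using \<xi> uu calculation unfolding odd_map_to_punctured_iff by (metis not_le)
    ultimately show ?thesis using True by (intro exI[of _ i]) (simp add: \<zeta>_def)
  next
    case False
    then obtain i where "\<mu> u i \<noteq> 0" using \<mu>_nz[OF u] by auto
    then show ?thesis by (intro exI[of _ "i + p"]) (simp add: \<zeta>_def)
  qed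
  moreover have "\<zeta> (- u) i = - \<zeta> u i" if "u \<in> A" for u i
    using \<xi> that unfolding odd_map_to_punctured_iff by (auto simp: \<zeta>_def e_even \<mu>_odd)
  moreover have "\<zeta> u i = 0" if "p + m \<le> i" for u i
    using that by (simp add: \<zeta>_def \<mu>_dim)
  ultimately show ?thesis unfolding odd_map_to_punctured_iff by blast
qed

text \<open>
  An odd map \<open>\<mu>\<close> into \<open>\<real>\<^sup>m\<close> together with an even 1-Lipschitz gauge \<open>e\<close> of the region where
  \<open>\<mu>\<close> does not vanish. The gauge takes the role of the distance to the compact set around which \<open>\<mu>\<close>
  is built; unlike that distance it is also meaningful when this set is empty.
\<close>

definition odd_cutoff :: "nat \<Rightarrow> ('a::real_normed_vector \<Rightarrow> nat \<Rightarrow> real) \<Rightarrow> ('a \<Rightarrow> real) \<Rightarrow> bool" where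
  "odd_cutoff m \<mu> e \<longleftrightarrow>
     (\<forall>i. continuous_on UNIV (\<lambda>u. \<mu> u i)) \<and> (\<forall>u i. \<mu> (- u) i = - \<mu> u i) \<and>
     (\<forall>u. \<forall>i\<ge>m. \<mu> u i = 0) \<and> (\<forall>u. 0 < e u \<longrightarrow> (\<exists>i. \<mu> u i \<noteq> 0)) \<and>
     (\<forall>u v. \<bar>e u - e v\<bar> \<le> norm (u - v)) \<and> (\<forall>u. e (- u) = e u)"

lemma continuous_on_odd_cutoff:
  assumes "odd_cutoff m \<mu> e"
  shows "continuous_on S e"
  using assms unfolding continuous_on_iff odd_cutoff_def
  by (metis dist_norm le_less_trans real_norm_def)

text \<open>
  A compact set avoiding \<open>0\<close> has a neighbourhood of finite genus. It is covered by finitely many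
  balls missing \<open>C\<close>; as \<open>0 \<in> C\<close>, such a ball is disjoint from its reflection, so the tent
  function of the ball minus that of the reflected ball is odd and nonzero on the ball. These
  differences are the components of \<open>\<mu>\<close>, and their absolute values add up to a multiple of \<open>e\<close>.
\<close>

lemma odd_cutoff_near_compact:
  fixes K C :: "'a::real_normed_vector set"
  assumes K: "compact K" and C: "closed C" "0 \<in> C" and Csym: "\<And>u. u \<in> C \<Longrightarrow> - u \<in> C"
    and disj: "K \<inter> C = {}"
  obtains m \<mu> e s where "odd_cutoff m \<mu> e" "s > 0" "\<forall>u\<in>K. 4 * s \<le> e u" "\<forall>u\<in>C. e u = 0"
proof -
  have "\<exists>r>0. ball x r \<inter> C = {}" if "x \<in> K" for x
  proof -
    have "open (- C)" "x \<in> - C" using C that disj by auto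
    then show ?thesis by (metis open_contains_ball disjoint_eq_subset_Compl)
  qed
  then obtain r where r: "\<And>x. x \<in> K \<Longrightarrow> r x > 0" "\<And>x. x \<in> K \<Longrightarrow> ball x (r x) \<inter> C = {}"
    by metis
  obtain D where D: "D \<subseteq> K" "finite D" "K \<subseteq> (\<Union>x\<in>D. ball x (r x))"
    using compactE_image[OF K, of K "\<lambda>x. ball x (r x)"] r(1) by force
  define m where "m = card D"
  obtain h where h: "bij_betw h {0..<m} D"
    unfolding m_def using ex_bij_betw_nat_finite[OF D(2)] by blast
  have hK: "h i \<in> K" if "i < m" for i
    using bij_betw_imp_surj_on[OF h] that D(1) by auto
  define p where "p x u = max 0 (r x - dist u x)" for x u
  have p_lip: "\<bar>p x u - p x v\<bar> \<le> norm (u - v)" for x u v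
    unfolding p_def dist_norm[symmetric]
    using dist_triangle[of u x v] dist_triangle[of v x u] dist_commute[of u v] by (smt (verit))
  have p_C: "p x u = 0" if "x \<in> K" "u \<in> C" for x u
    using r(2)[OF that(1)] that(2) by (force simp: p_def dist_commute disjoint_iff not_less)
  define \<mu> where "\<mu> u i = (if i < m then p (h i) u - p (h i) (- u) else 0)" for u i
  \<comment> \<open>Each component is 2-Lipschitz; the summand 1 keeps \<open>L\<close> positive when the cover is empty.\<close>
  define L where "L = 2 * real m + 1"
  define e where "e u = (\<Sum>i<m. \<bar>\<mu> u i\<bar>) / L" for u
  have L: "L > 0" by (simp add: L_def)
  have \<mu>_cont: "continuous_on UNIV (\<lambda>u. \<mu> u i)" for i
    unfolding \<mu>_def p_def by (cases "i < m") (auto intro!: continuous_intros)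
  have \<mu>_odd: "\<mu> (- u) i = - \<mu> u i" for u i by (simp add: \<mu>_def)
  have \<mu>_lip: "\<bar>\<mu> u i - \<mu> v i\<bar> \<le> 2 * norm (u - v)" for u v i
    using p_lip[of "h i" u v] p_lip[of "h i" "- u" "- v"]
    unfolding minus_diff_minus norm_minus_cancel \<mu>_def by (smt (verit) norm_ge_zero)
  have e_lip: "\<bar>e u - e v\<bar> \<le> norm (u - v)" for u v
  proof -
    have "\<bar>(\<Sum>i<m. \<bar>\<mu> u i\<bar>) - (\<Sum>i<m. \<bar>\<mu> v i\<bar>)\<bar> \<le> (\<Sum>i<m. \<bar>\<bar>\<mu> u i\<bar> - \<bar>\<mu> v i\<bar>\<bar>)"
      unfolding sum_subtractf[symmetric] by (rule sum_abs)
    also have "\<dots> \<le> (\<Sum>i<m. 2 * norm (u - v))"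
      using \<mu>_lip by (intro sum_mono) (meson abs_triangle_ineq3 order_trans)
    also have "\<dots> \<le> L * norm (u - v)" by (simp add: L_def algebra_simps)
    finally show ?thesis
      using L by (simp add: e_def field_simps flip: diff_divide_distrib)
  qed
  have e_even: "e (- u) = e u" for u by (simp add: e_def \<mu>_odd)
  have e_nz: "\<exists>i. \<mu> u i \<noteq> 0" if "0 < e u" for u
  proof (rule ccontr)
    assume "\<not> ?thesis"
    then have "e u = 0" by (simp add: e_def)
    then show False using that by simp
  qed
  have e_C: "e u = 0" if "u \<in> C" for u
    using that Csym by (auto simp: e_def \<mu>_def p_C hK intro!: sum.neutral)
  have e_K: "0 < e u" if u: "u \<in> K" for u
  proof -
    obtain x where x: "x \<in> D" "dist x u < r x" using D(3) u by auto
    then obtain i where i: "i < m" "h i = x" using h by (auto simp: bij_betw_def)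
    have "0 \<notin> ball x (r x)" using r(2)[of x] x(1) D(1) C(2) by blast
    then have "r x \<le> norm x" by simp
    moreover have "2 * norm x \<le> dist x u + dist (- u) x"
      using norm_triangle_ineq[of "x - u" "x + u"]
      by (simp add: dist_norm norm_minus_commute scaleR_2[symmetric])
    ultimately have "r x \<le> dist (- u) x" using x(2) by linarith
    then have "\<mu> u i \<noteq> 0" using x(2) i by (simp add: \<mu>_def p_def dist_commute)
    then have "0 < (\<Sum>i<m. \<bar>\<mu> u i\<bar>)" using i by (intro sum_pos2[of _ i]) auto
    then show ?thesis using L by (simp add: e_def)
  qed
  have e_cont: "continuous_on UNIV e" unfolding e_def
    using \<mu>_cont L by (intro continuous_intros) auto
  have "\<exists>s>0. \<forall>u\<in>K. 4 * s \<le> e u"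
  proof (cases "K = {}")
    case False
    then obtain x where "x \<in> K" "\<forall>y\<in>K. e x \<le> e y"
      using continuous_attains_inf[OF K _ continuous_on_subset[OF e_cont]] by blast
    then show ?thesis using e_K by (intro exI[of _ "e x / 4"]) auto
  qed (auto intro: exI[of _ 1])
  then obtain s where "s > 0" "\<forall>u\<in>K. 4 * s \<le> e u" by blast
  moreover have "odd_cutoff m \<mu> e"
    using \<mu>_cont \<mu>_odd e_lip e_even e_nz by (simp add: odd_cutoff_def \<mu>_def)
  ultimately show ?thesis using e_C by (intro that) auto
qed

text \<open>
  Genus growth across a band. Away from the region gauged by \<open>e\<close> the sublevel set at \<open>b\<close> is moved
  into the one at \<open>a\<close>, which contributes \<open>p\<close>; the rest is covered by \<open>\<mu>\<close> and contributes \<open>m\<close>.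
  The dimension \<open>m\<close> does not depend on the band.
\<close>

lemma odd_map_on_higher_sublevel:
  fixes I :: "'a::banach \<Rightarrow> real"
  assumes C1: "C1_functional I I'" and I0: "I 0 = 0" and ev: "\<And>u. I (- u) = I u"
    and a: "a \<le> 0"
    and \<zeta>: "odd_map_to_punctured {u. I u \<le> a} p \<zeta>"
    and cut: "odd_cutoff m \<mu> e"
    and s: "s > 0" and \<delta>: "\<delta> > 0" and \<delta>': "\<delta>' > 0"
    and grad: "\<And>u. a \<le> I u \<Longrightarrow> I u \<le> b \<Longrightarrow> e u \<le> 3 * s \<Longrightarrow> \<delta> \<le> norm (I' u)"
    and grad': "\<And>u. a \<le> I u \<Longrightarrow> I u \<le> b \<Longrightarrow> s \<le> e u \<Longrightarrow> e u \<le> 3 * s \<Longrightarrow> \<delta>' \<le> norm (I' u)"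
    and ab: "b - a < \<delta>' * s / 4"
  shows "\<exists>\<zeta>. odd_map_to_punctured {u. I u \<le> b} (p + m) \<zeta>"
proof -
  obtain G where G: "continuous_on {u. I u \<le> b \<and> e u \<le> 2 * s} G"
    "\<And>u. I u \<le> b \<Longrightarrow> e u \<le> 2 * s \<Longrightarrow> I (G u) \<le> a"
    "\<And>u. I u \<le> b \<Longrightarrow> e u \<le> 2 * s \<Longrightarrow> G (- u) = - G u"
    using odd_deformation[OF C1 I0 ev a _ s \<delta> \<delta>' grad grad' ab] cut
    unfolding odd_cutoff_def by blast
  have "odd_map_to_punctured {u \<in> {u. I u \<le> b}. e u \<le> 2 * s} p (\<lambda>u. \<zeta> (G u))"
    using G by (intro odd_map_to_punctured_compose[OF \<zeta>]) auto
  moreover have "\<exists>i. \<mu> u i \<noteq> 0" if "2 * s \<le> e u" for u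
  proof -
    have "0 < e u" using that s by linarith
    then show ?thesis using cut by (simp add: odd_cutoff_def)
  qed
  ultimately show ?thesis
    using cut continuous_on_odd_cutoff[OF cut]
    by (intro odd_map_to_punctured_union[where e=e and t="2 * s" and \<mu>=\<mu>])
       (auto simp: odd_cutoff_def intro: continuous_on_subset)
qed

section \<open>Consequences of the Palais-Smale condition\<close>

lemma PS_limit:
  assumes C1: "C1_functional I I'" and PS: "PS_cond I I' c"
    and I_lim: "(\<lambda>j. I (u j)) \<longlonglongrightarrow> c" and I'_lim: "(\<lambda>j. norm (I' (u j))) \<longlonglongrightarrow> 0"
  obtains r l where "strict_mono (r :: nat \<Rightarrow> nat)" "(u \<circ> r) \<longlonglongrightarrow> l" "I' l = 0" "I l = c"
proof -
  obtain r l where r: "strict_mono (r :: nat \<Rightarrow> nat)" and l: "(u \<circ> r) \<longlonglongrightarrow> l"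
    using PS I_lim I'_lim unfolding PS_cond_def convergent_def by blast
  have I_cont: "continuous_on UNIV I" and I'_cont: "continuous_on UNIV I'"
    using C1 by (auto simp: C1_functional_def intro!: has_derivative_continuous_on)
  have "(\<lambda>j. I ((u \<circ> r) j)) \<longlonglongrightarrow> I l"
    by (rule continuous_on_tendsto_compose[OF I_cont l]) auto
  moreover have "(\<lambda>j. I ((u \<circ> r) j)) \<longlonglongrightarrow> c"
    using LIMSEQ_subseq_LIMSEQ[OF I_lim r] by (simp add: o_def)
  ultimately have "I l = c" by (rule LIMSEQ_unique)
  have "(\<lambda>j. norm (I' ((u \<circ> r) j))) \<longlonglongrightarrow> norm (I' l)"
    by (intro tendsto_norm continuous_on_tendsto_compose[OF I'_cont l]) auto
  moreover have "(\<lambda>j. norm (I' ((u \<circ> r) j))) \<longlonglongrightarrow> 0"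
    using LIMSEQ_subseq_LIMSEQ[OF I'_lim r] by (simp add: o_def)
  ultimately have "norm (I' l) = 0" by (rule LIMSEQ_unique)
  with r l \<open>I l = c\<close> show ?thesis by (intro that) auto
qed

lemma LIMSEQ_zero_of_le_inverse:
  fixes f :: "nat \<Rightarrow> real"
  assumes "\<And>n. \<bar>f n\<bar> \<le> 1 / real (Suc n)"
  shows "f \<longlonglongrightarrow> 0"
  by (rule Lim_null_comparison[OF _ LIMSEQ_inverse_real_of_nat])
     (use assms in \<open>simp add: divide_inverse\<close>)

text \<open>
  Otherwise there are points of \<open>F\<close> whose values tend to \<open>c\<close> and whose derivatives tend to zero, and
  the Palais-Smale condition yields a critical point of \<open>F\<close> at level \<open>c\<close>.
\<close>

lemma gradient_bound_near_level:
  assumes C1: "C1_functional I I'" and PS: "PS_cond I I' c" and F: "closed F"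
    and nocrit: "\<And>u. u \<in> F \<Longrightarrow> I' u = 0 \<Longrightarrow> I u \<noteq> c"
  obtains \<epsilon> \<delta> where "\<epsilon> > 0" "\<delta> > 0" "\<And>u. u \<in> F \<Longrightarrow> \<bar>I u - c\<bar> \<le> \<epsilon> \<Longrightarrow> \<delta> \<le> norm (I' u)"
proof (rule ccontr)
  assume "\<not> thesis"
  then have neg: "\<And>\<epsilon>. \<epsilon> > 0 \<Longrightarrow> \<exists>u. u \<in> F \<and> \<bar>I u - c\<bar> \<le> \<epsilon> \<and> norm (I' u) < \<epsilon>"
    using that by (meson not_le)
  have "\<exists>u. u \<in> F \<and> \<bar>I u - c\<bar> \<le> 1 / real (Suc n) \<and> norm (I' u) < 1 / real (Suc n)" for n
    by (rule neg) simp
  then obtain u where u: "\<And>n. u n \<in> F" "\<And>n. \<bar>I (u n) - c\<bar> \<le> 1 / real (Suc n)"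
    "\<And>n. norm (I' (u n)) < 1 / real (Suc n)" by metis
  have "(\<lambda>n. I (u n) - c) \<longlonglongrightarrow> 0" by (rule LIMSEQ_zero_of_le_inverse) (rule u)
  then have "(\<lambda>n. I (u n)) \<longlonglongrightarrow> c" by (simp add: LIM_zero_iff)
  moreover have "(\<lambda>n. norm (I' (u n))) \<longlonglongrightarrow> 0"
    using u(3) by (intro LIMSEQ_zero_of_le_inverse) (simp add: less_imp_le)
  ultimately obtain r l where "strict_mono (r :: nat \<Rightarrow> nat)" and l: "(u \<circ> r) \<longlonglongrightarrow> l" "I' l = 0" "I l = c"
    by (rule PS_limit[OF C1 PS])
  have "l \<in> F" by (rule closed_sequentially[OF F _ l(1)]) (simp add: u)
  then show False using nocrit l by blast
qed

lemma gradient_bound_on_band: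
  assumes C1: "C1_functional I I'" and PS: "\<And>c. a \<le> c \<Longrightarrow> c \<le> b \<Longrightarrow> PS_cond I I' c" and F: "closed F"
    and nocrit: "\<And>u. u \<in> F \<Longrightarrow> I' u = 0 \<Longrightarrow> a \<le> I u \<Longrightarrow> I u \<le> b \<Longrightarrow> False"
  obtains \<delta> where "\<delta> > 0" "\<And>u. u \<in> F \<Longrightarrow> a \<le> I u \<Longrightarrow> I u \<le> b \<Longrightarrow> \<delta> \<le> norm (I' u)"
proof (rule ccontr)
  assume "\<not> thesis"
  then have neg: "\<And>\<delta>. \<delta> > 0 \<Longrightarrow> \<exists>u. u \<in> F \<and> a \<le> I u \<and> I u \<le> b \<and> norm (I' u) < \<delta>"
    using that by (meson not_le)
  have "\<exists>u. u \<in> F \<and> a \<le> I u \<and> I u \<le> b \<and> norm (I' u) < 1 / real (Suc n)" for n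
    by (rule neg) simp
  then obtain u where u: "\<And>n. u n \<in> F" "\<And>n. a \<le> I (u n)" "\<And>n. I (u n) \<le> b"
    "\<And>n. norm (I' (u n)) < 1 / real (Suc n)" by metis
  have lim: "(\<lambda>n. norm (I' (u n))) \<longlonglongrightarrow> 0"
    using u(4) by (intro LIMSEQ_zero_of_le_inverse) (simp add: less_imp_le)
  have "seq_compact {a..b}" by (simp add: compact_imp_seq_compact)
  moreover have "\<forall>n. I (u n) \<in> {a..b}" using u by simp
  ultimately obtain c q where c: "c \<in> {a..b}" and q: "strict_mono (q :: nat \<Rightarrow> nat)"
    and Iq: "((\<lambda>n. I (u n)) \<circ> q) \<longlonglongrightarrow> c"
    unfolding seq_compact_def by metis
  have "(\<lambda>n. I ((u \<circ> q) n)) \<longlonglongrightarrow> c" using Iq by (simp add: o_def)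
  moreover have "(\<lambda>n. norm (I' ((u \<circ> q) n))) \<longlonglongrightarrow> 0"
    using LIMSEQ_subseq_LIMSEQ[OF lim q] by (simp add: o_def)
  ultimately obtain r l where "strict_mono (r :: nat \<Rightarrow> nat)" and l: "(u \<circ> q \<circ> r) \<longlonglongrightarrow> l" "I' l = 0" "I l = c"
    using PS_limit[OF C1 PS] c by (metis atLeastAtMost_iff)
  have "l \<in> F" by (rule closed_sequentially[OF F _ l(1)]) (simp add: u)
  then show False using nocrit l c by auto
qed

lemma compact_critical_level:
  assumes C1: "C1_functional I I'" and PS: "PS_cond I I' c"
  shows "compact {u. I' u = 0 \<and> I u = c}"
  unfolding compact_eq_seq_compact_metric seq_compact_def
proof (intro allI impI)
  fix u :: "nat \<Rightarrow> _" assume "\<forall>n. u n \<in> {u. I' u = 0 \<and> I u = c}"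
  then have "(\<lambda>j. I (u j)) \<longlonglongrightarrow> c" "(\<lambda>j. norm (I' (u j))) \<longlonglongrightarrow> 0" by auto
  then obtain r l where "strict_mono (r :: nat \<Rightarrow> nat)" "(u \<circ> r) \<longlonglongrightarrow> l" "I' l = 0" "I l = c"
    by (rule PS_limit[OF C1 PS])
  then show "\<exists>l\<in>{u. I' u = 0 \<and> I u = c}. \<exists>r. strict_mono r \<and> (u \<circ> r) \<longlonglongrightarrow> l" by blast
qed

text \<open>
  In a compact space components and quasi-components agree, so \<open>{0}\<close> can be separated
  from the points of norm at least \<open>\<rho>\<close> by a clopen set. Intersecting it with its reflection makes it
  symmetric.
\<close>

lemma split_off_point_component:
  fixes K :: "'a::real_normed_vector set"
  assumes K: "compact K" and sym: "\<And>u. u \<in> K \<Longrightarrow> - u \<in> K"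
    and comp: "connected_component_set K 0 = {0}" and \<rho>: "\<rho> > 0"
  obtains K1 K2 where "K = K1 \<union> K2" "K1 \<inter> K2 = {}" "closed K1" "compact K2" "0 \<in> K1"
    "\<forall>u\<in>K1. - u \<in> K1" "\<forall>u\<in>K1. norm u < \<rho>"
proof -
  have 0: "0 \<in> K"
    using comp connected_component_in by fastforce
  let ?X = "top_of_set K"
  have "separated_between ?X {0} (K - ball 0 \<rho>)"
  proof (rule cut_wire_fence_theorem_gen)
    show "compact_space ?X" using K by (simp add: compact_space_subtopology)
    show "Hausdorff_space ?X \<or> regular_space ?X \<or> normal_space ?X"
      by (simp add: Hausdorff_space_subtopology)
    show "compactin ?X {0}" using 0 by (simp add: compactin_subtopology)
    show "closedin ?X (K - ball 0 \<rho>)"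
      unfolding Diff_eq by (intro closedin_closed_Int) (simp add: closed_def)
    fix C assume "connectedin ?X C"
    then have "connected C" "C \<subseteq> K" by (auto simp: connectedin_subtopology)
    then have "0 \<in> C \<Longrightarrow> C \<subseteq> {0}" using connected_component_maximal comp by blast
    then show "disjnt C {0} \<or> disjnt C (K - ball 0 \<rho>)" using \<rho> by (fastforce simp: disjnt_iff)
  qed
  then obtain U V where U: "openin ?X U" "openin ?X V" "U \<union> V = K" "U \<inter> V = {}"
    "0 \<in> U" "K - ball 0 \<rho> \<subseteq> V"
    unfolding separated_between_def disjnt_def by auto
  obtain U' where U': "open U'" "U = K \<inter> U'" using U(1) openin_open by blast
  obtain V' where V': "open V'" "V = K \<inter> V'" using U(2) openin_open by blast
  have "U = K - V'" using U V' by blast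
  then have cU: "closed U" using compact_imp_closed[OF K] V' by auto
  define K1 where "K1 = U \<inter> uminus ` U"
  define W where "W = U' \<inter> uminus ` U'"
  have W: "open W" "K1 = K \<inter> W"
    using U' by (auto simp: W_def K1_def open_negations sym) (use sym in force)+
  show ?thesis
  proof (rule that[of K1 "K - W"])
    show "K = K1 \<union> (K - W)" "K1 \<inter> (K - W) = {}" using W by auto
    show "closed K1" unfolding K1_def using cU by (intro closed_Int closed_negations)
    show "compact (K - W)" using K W(1) by (rule compact_diff)
    show "0 \<in> K1" using U(5) by (force simp: K1_def)
    show "\<forall>u\<in>K1. - u \<in> K1" by (force simp: K1_def)
    show "\<forall>u\<in>K1. norm u < \<rho>"
    proof
      fix u assume "u \<in> K1"
      then have "u \<in> U" by (simp add: K1_def)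
      then have "u \<in> K" "u \<notin> V" using U by auto
      then show "norm u < \<rho>" using U(6) by auto
    qed
  qed
qed

section \<open>The component of the origin\<close>

theorem corollary1p5:
  fixes I :: "'a::banach \<Rightarrow> real"
    and I' :: "'a \<Rightarrow> 'a \<Rightarrow>\<^sub>L real"
  assumes C1: "C1_functional I I'"
    and A1_zero: "I 0 = 0"
    and A1_even: "\<And>u. I (- u) = I u"
    and A1_bounded_below: "bdd_below (range I)"
    and A2: "\<And>c. c \<le> 0 \<Longrightarrow> PS_cond I I' c"
    and A3: "\<And>k::nat. k \<ge> 1 \<Longrightarrow>
      \<exists>A\<in>sym_closed_sets. genus A \<ge> enat k \<and> (SUP u\<in>A. ereal (I u)) < 0"
    and no_seq: "\<not> (\<exists>u::nat \<Rightarrow> 'a. (\<forall>j. I' (u j) = 0 \<and> I (u j) < 0) \<and> u \<longlonglongrightarrow> 0)"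
  shows "zero_critical_component I I' \<noteq> {0}"
proof
  assume comp: "zero_critical_component I I' = {0}"
  let ?Y = "\<lambda>a. {u. I u \<le> a}"
  define S where "S = {a. a < 0 \<and> (\<exists>n \<zeta>. odd_map_to_punctured (?Y a) n \<zeta>)}"
  have odd_I': "I' (- u) = - I' u" for u by (rule derivative_of_even[OF C1 A1_even])
  \<comment> \<open>The sets of large genus sit inside sublevel sets, whose genus is therefore unbounded near level 0.\<close>
  have large: "\<exists>b<0. \<forall>n \<zeta>. odd_map_to_punctured (?Y b) n \<zeta> \<longrightarrow> k \<le> n" if k: "k \<ge> 1" for k
  proof -
    obtain A where A: "genus A \<ge> enat k" "(SUP u\<in>A. ereal (I u)) < 0"
      using A3[OF k] by blast
    then obtain b where b: "(SUP u\<in>A. ereal (I u)) < ereal b" "ereal b < 0"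
      using ereal_dense2 by blast
    have "A \<subseteq> ?Y b"
    proof
      fix u assume "u \<in> A"
      then have "ereal (I u) \<le> (SUP u\<in>A. ereal (I u))" by (rule SUP_upper)
      also have "\<dots> < ereal b" by (rule b)
      finally show "u \<in> ?Y b" by simp
    qed
    have "k \<le> n" if "odd_map_to_punctured (?Y b) n \<zeta>" for n \<zeta>
    proof -
      have "odd_map_to_punctured A n \<zeta>"
        using that \<open>A \<subseteq> ?Y b\<close> by (rule odd_map_to_punctured_subset)
      then have "genus A \<le> enat n" unfolding genus_def by (intro Inf_lower) blast
      then show ?thesis using A(1) by (metis enat_ord_simps(1) order_trans)
    qed
    then show ?thesis using b(2) by (auto simp: zero_ereal_def)
  qed
  obtain B where B: "\<And>u. B \<le> I u" using A1_bounded_below by (auto simp: bdd_below_def)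
  have "?Y (min B 0 - 1) = {}"
  proof -
    have "\<not> I u \<le> min B 0 - 1" for u using B[of u] by linarith
    then show ?thesis by blast
  qed
  then have "odd_map_to_punctured (?Y (min B 0 - 1)) 0 (\<lambda>_ _. 0)"
    by (simp add: odd_map_to_punctured_iff)
  then have S_ne: "S \<noteq> {}" unfolding S_def by force
  have S_bdd: "bdd_above S" by (auto simp: S_def bdd_above_def intro!: exI[of _ 0])
  have S_down: "\<exists>n \<zeta>. odd_map_to_punctured (?Y a) n \<zeta>" if a: "a < Sup S" for a
  proof -
    obtain a' where "a' \<in> S" "a < a'" using a less_cSup_iff[OF S_ne S_bdd] by blast
    then obtain n \<zeta> where "odd_map_to_punctured (?Y a') n \<zeta>" by (auto simp: S_def)
    then have "odd_map_to_punctured (?Y a) n \<zeta>"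
      using \<open>a < a'\<close> by (auto elim!: odd_map_to_punctured_subset)
    then show ?thesis by blast
  qed
  have e_closed: "closed {u. e u \<le> t}" "closed {u. t \<le> e u}" if "odd_cutoff m \<mu> e"
    for m \<mu> and e :: "'a \<Rightarrow> real" and t
    using continuous_on_odd_cutoff[OF that] by (auto intro!: closed_Collect_le continuous_intros)
  have "Sup S \<le> 0" by (rule cSup_least[OF S_ne]) (auto simp: S_def)
  then consider "Sup S < 0" | "Sup S = 0" by linarith
  then show False
  proof cases
    \<comment> \<open>Clark's theorem: all critical points at level \<open>c < 0\<close> are away from \<open>0\<close>, so finite genus
      would persist slightly above \<open>c\<close>.\<close>
    case 1
    define c where "c = Sup S"
    have c: "c < 0" using 1 by (simp add: c_def)
    let ?K = "{u. I' u = 0 \<and> I u = c}"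
    have PS: "PS_cond I I' c" using A2 c by simp
    obtain m \<mu> e s where cut: "odd_cutoff m \<mu> e" and s: "s > 0" and eK: "\<forall>u\<in>?K. 4 * s \<le> e u"
    proof (rule odd_cutoff_near_compact[OF compact_critical_level[OF C1 PS]])
      show "closed {0::'a}" by simp
      show "(0::'a) \<in> {0}" by simp
      show "- u \<in> {0}" if "u \<in> {0}" for u :: 'a using that by simp
      show "?K \<inter> {0} = {}" using c A1_zero by auto
    qed (rule that)
    obtain \<epsilon> \<delta> where \<epsilon>: "\<epsilon> > 0" and \<delta>: "\<delta> > 0"
      and grad: "\<And>u. u \<in> {u. e u \<le> 3 * s} \<Longrightarrow> \<bar>I u - c\<bar> \<le> \<epsilon> \<Longrightarrow> \<delta> \<le> norm (I' u)"
      by (rule gradient_bound_near_level[OF C1 PS, of "{u. e u \<le> 3 * s}"])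
         (use e_closed[OF cut] eK s in fastforce)+
    define \<eta> where "\<eta> = Min {\<epsilon>, \<delta> * s / 16, - c / 2}"
    have \<eta>: "\<eta> > 0" "\<eta> \<le> \<epsilon>" "\<eta> \<le> \<delta> * s / 16" "\<eta> \<le> - c / 2"
      using \<epsilon> \<delta> s c by (auto simp: \<eta>_def)
    obtain p \<zeta> where "odd_map_to_punctured (?Y (c - \<eta>)) p \<zeta>"
      using S_down[of "c - \<eta>"] \<eta>(1) by (auto simp: c_def)
    moreover have "c - \<eta> \<le> 0" using c \<eta> by linarith
    moreover have "\<delta> \<le> norm (I' u)" if "c - \<eta> \<le> I u" "I u \<le> c + \<eta>" "e u \<le> 3 * s" for u
      using grad[of u] that \<eta> by (simp add: abs_le_iff)
    moreover have "(c + \<eta>) - (c - \<eta>) < \<delta> * s / 4"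
    proof -
      have "0 < \<delta> * s" using \<delta> s by simp
      then show ?thesis using \<eta>(3) by linarith
    qed
    ultimately have "\<exists>\<zeta>. odd_map_to_punctured (?Y (c + \<eta>)) (p + m) \<zeta>"
      by (intro odd_map_on_higher_sublevel[OF C1 A1_zero A1_even _ _ cut s \<delta> \<delta>]) auto
    then have "c + \<eta> \<in> S" using \<eta> c by (auto simp: S_def)
    then have "c + \<eta> \<le> c" unfolding c_def by (rule cSup_upper[OF _ S_bdd])
    then show False using \<eta> by simp
  next
    \<comment> \<open>At level 0 only the critical points in \<open>K2\<close> are cut out; those in \<open>K1\<close> are harmless because
      they are not approached by critical points with negative values.\<close>
    case 2
    have PS: "PS_cond I I' 0" using A2 by simp
    have "\<exists>\<rho>>0. \<forall>u. I' u = 0 \<and> I u < 0 \<longrightarrow> \<rho> \<le> norm u"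
    proof (rule ccontr)
      assume *: "\<not> ?thesis"
      have "\<exists>u. I' u = 0 \<and> I u < 0 \<and> norm u < 1 / real (Suc n)" for n
        using * by (metis not_le of_nat_0_less_iff zero_less_Suc zero_less_divide_1_iff)
      then obtain u where u: "\<And>n. I' (u n) = 0" "\<And>n. I (u n) < 0" "\<And>n. norm (u n) < 1 / real (Suc n)"
        by metis
      have "(\<lambda>n. norm (u n)) \<longlonglongrightarrow> 0"
        using u(3) by (intro LIMSEQ_zero_of_le_inverse) (simp add: less_imp_le)
      then have "u \<longlonglongrightarrow> 0" by (simp add: tendsto_norm_zero_iff)
      then show False using no_seq u by blast
    qed
    then obtain \<rho> where \<rho>: "\<rho> > 0" "\<And>u. I' u = 0 \<Longrightarrow> I u < 0 \<Longrightarrow> \<rho> \<le> norm u" by blast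
    let ?K = "{u. I' u = 0 \<and> I u = 0}"
    obtain K1 K2 where K12: "?K = K1 \<union> K2" "K1 \<inter> K2 = {}" and K1: "closed K1"
      and K2: "compact K2" and K1': "0 \<in> K1" "\<forall>u\<in>K1. - u \<in> K1" "\<forall>u\<in>K1. norm u < \<rho>"
    proof (rule split_off_point_component[OF compact_critical_level[OF C1 PS]])
      show "- u \<in> ?K" if "u \<in> ?K" for u using that by (simp add: odd_I' A1_even)
      show "connected_component_set ?K 0 = {0}"
        using comp by (simp add: zero_critical_component_def zero_critical_set_def)
    qed (use \<rho>(1) that in blast)+
    have "K2 \<inter> K1 = {}" using K12 by blast
    then obtain m \<mu> e s where cut: "odd_cutoff m \<mu> e" and s: "s > 0"
      and eK2: "\<forall>u\<in>K2. 4 * s \<le> e u" and eK1: "\<forall>u\<in>K1. e u = 0"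
      using odd_cutoff_near_compact[OF K2 K1 K1'(1)] K1'(2) by blast
    have crit0: "u \<in> K1 \<or> u \<in> K2" if "I' u = 0" "I u = 0" for u using K12 that by blast
    obtain \<epsilon>1 \<delta>' where \<epsilon>1: "\<epsilon>1 > 0" and \<delta>': "\<delta>' > 0"
      and grad': "\<And>u. u \<in> {u. e u \<le> 3 * s} \<inter> {u. s \<le> e u} \<Longrightarrow> \<bar>I u - 0\<bar> \<le> \<epsilon>1 \<Longrightarrow> \<delta>' \<le> norm (I' u)"
    proof (rule gradient_bound_near_level[OF C1 PS, of "{u. e u \<le> 3 * s} \<inter> {u. s \<le> e u}"])
      show "closed ({u. e u \<le> 3 * s} \<inter> {u. s \<le> e u})" using e_closed[OF cut] by blast
      show "I u \<noteq> 0" if "u \<in> {u. e u \<le> 3 * s} \<inter> {u. s \<le> e u}" "I' u = 0" for u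
        using crit0[of u] bspec[OF eK1, of u] bspec[OF eK2, of u] s that by auto
    qed (rule that)
    \<comment> \<open>Negative critical values tending to 0 would produce a limit in \<open>K1\<close>, which is inside the ball of
      radius \<open>\<rho>\<close>, although the critical points themselves stay outside of it.\<close>
    have "\<exists>\<epsilon>>0. \<forall>u. I' u = 0 \<and> - \<epsilon> \<le> I u \<and> I u < 0 \<longrightarrow> 3 * s < e u"
    proof (rule ccontr)
      assume *: "\<not> ?thesis"
      have "\<exists>u. I' u = 0 \<and> - (1 / real (Suc n)) \<le> I u \<and> I u < 0 \<and> e u \<le> 3 * s" for n
        using * by (metis not_le of_nat_0_less_iff zero_less_Suc zero_less_divide_1_iff)
      then obtain u where u: "\<And>n. I' (u n) = 0" "\<And>n. - (1 / real (Suc n)) \<le> I (u n)"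
        "\<And>n. I (u n) < 0" "\<And>n. e (u n) \<le> 3 * s" by metis
      have "\<bar>I (u n)\<bar> \<le> 1 / real (Suc n)" for n using u(2,3)[of n] by linarith
      then have "(\<lambda>n. I (u n)) \<longlonglongrightarrow> 0" by (rule LIMSEQ_zero_of_le_inverse)
      moreover have "(\<lambda>n. norm (I' (u n))) \<longlonglongrightarrow> 0" by (simp add: u)
      ultimately obtain r l where "strict_mono (r :: nat \<Rightarrow> nat)" and l: "(u \<circ> r) \<longlonglongrightarrow> l" "I' l = 0" "I l = 0"
        by (rule PS_limit[OF C1 PS])
      have "closed {u. e u \<le> 3 * s}" using e_closed[OF cut] by blast
      then have "l \<in> {u. e u \<le> 3 * s}" by (rule closed_sequentially[OF _ _ l(1)]) (simp add: u)
      then have "norm l < \<rho>" using crit0[OF l(2,3)] eK2 s K1'(3) by auto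
      moreover have "\<rho> \<le> norm l"
        by (rule LIMSEQ_le_const[OF tendsto_norm[OF l(1)]]) (use \<rho>(2) u in auto)
      ultimately show False by simp
    qed
    then obtain \<epsilon>2 where \<epsilon>2: "\<epsilon>2 > 0" "\<And>u. I' u = 0 \<Longrightarrow> - \<epsilon>2 \<le> I u \<Longrightarrow> I u < 0 \<Longrightarrow> 3 * s < e u" by blast
    \<comment> \<open>The height \<open>\<eta>\<close> depends on the bound \<open>\<delta>'\<close> around \<open>K2\<close>, which holds up to level 0, and not on \<open>\<delta>\<close>
      below, which degenerates as \<open>b\<close> tends to 0. This is why \<open>p + m\<close> bounds the genus for all \<open>b < 0\<close>.\<close>
    define \<eta> where "\<eta> = Min {\<epsilon>1, \<epsilon>2, \<delta>' * s / 8}"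
    have \<eta>: "\<eta> > 0" "\<eta> \<le> \<epsilon>1" "\<eta> \<le> \<epsilon>2" "\<eta> \<le> \<delta>' * s / 8"
      using \<epsilon>1 \<epsilon>2 \<delta>' s by (auto simp: \<eta>_def)
    obtain p \<zeta> where \<zeta>: "odd_map_to_punctured (?Y (- \<eta>)) p \<zeta>"
      using S_down[of "- \<eta>"] \<eta>(1) 2 by auto
    obtain b where b: "b < 0" "\<And>n \<zeta>. odd_map_to_punctured (?Y b) n \<zeta> \<Longrightarrow> p + m + 1 \<le> n"
      using large[of "p + m + 1"] by auto
    obtain \<delta> where \<delta>: "\<delta> > 0"
      and grad: "\<And>u. u \<in> {u. e u \<le> 3 * s} \<Longrightarrow> - \<eta> \<le> I u \<Longrightarrow> I u \<le> b \<Longrightarrow> \<delta> \<le> norm (I' u)"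
    proof (rule gradient_bound_on_band[OF C1])
      show "PS_cond I I' c" if "- \<eta> \<le> c" "c \<le> b" for c
        using that b(1) by (intro A2) linarith
      show "closed {u. e u \<le> 3 * s}" by (rule e_closed[OF cut])
      show False if "u \<in> {u. e u \<le> 3 * s}" "I' u = 0" "- \<eta> \<le> I u" "I u \<le> b" for u
      proof -
        have "- \<epsilon>2 \<le> I u" "I u < 0" using that \<eta>(3) b(1) by linarith+
        then show False using \<epsilon>2(2)[OF \<open>I' u = 0\<close>] that(1) by simp
      qed
    qed (rule that)
    have "\<exists>\<zeta>. odd_map_to_punctured (?Y b) (p + m) \<zeta>"
    proof (rule odd_map_on_higher_sublevel[OF C1 A1_zero A1_even _ \<zeta> cut s \<delta> \<delta>'])
      show "- \<eta> \<le> 0" using \<eta> by simp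
      show "\<delta> \<le> norm (I' u)" if "- \<eta> \<le> I u" "I u \<le> b" "e u \<le> 3 * s" for u
        using grad that by simp
      show "\<delta>' \<le> norm (I' u)" if "- \<eta> \<le> I u" "I u \<le> b" "s \<le> e u" "e u \<le> 3 * s" for u
        using grad'[of u] that b \<eta> by simp
      have "0 < \<delta>' * s" using \<delta>' s by simp
      then show "b - - \<eta> < \<delta>' * s / 4" using b(1) \<eta>(4) by linarith
    qed
    then obtain \<zeta>' where "odd_map_to_punctured (?Y b) (p + m) \<zeta>'" ..
    from b(2)[OF this] show False by simp
  qed
qed

end
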